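(* Let $\phi$ be an admissible function with associated function $\psi(r)=\frac{r}{\phi(r)}$ such that $\phi(0^+)=0$, and let $2<p<\infty$ and $q=\frac{p}{p-1}$. Then there is a compact set $X\subset\mathbb{C}$ containing $0$ such that for each $\epsilon>0$ the set $$\{y\in X: |f(y)-f(0)|\le \epsilon\,\phi(|y|)\,\|f\|_{L^p(X)}\ \text{ for all } f\in R_0(X)\}$$ has full area density at $0$, but $$\sum_{n=1}^{\infty}\phi(2^{-n})^{-q}\,2^{nq}\,\Gamma_q(A_n(0)\setminus X)=\infty .$$
   Context: A function $\phi$ is admissible if it is positive and non-decreasing on $(0,\infty)$ and the associated function $\psi(r)=r/\phi(r)$ is also positive and non-decreasing on $(0,\infty)$ with $\psi(0^+)=0$. (At $y=0$ one reads $\phi(0)=0$; this single point is immaterial.) $m$ denotes area (two-dimensional Lebesgue) measure on $\mathbb{C}$, $L^p(X)$ is taken with respect to $m$ restricted to $X$, and $R_0(X)$ is the set of rational functions with poles off $X$. $A_n(x)=\{z\in\mathbb{C}:2^{-(n+1)}<|z-x|<2^{-n}\}$, and $B(x,r)$ is the disk with center $x$ and radius $r$. A set $E$ has full area density at $x$ if $\frac{m(B(x,r)\setminus E)}{m(B(x,r))}\to0$ as $r\to0$. For $1<q<2$, the $q$-capacity of a compact set $K\subset\mathbb{C}$ is $\Gamma_q(K)=\inf\int|\nabla u|^q\,dm$, the infimum being over all infinitely differentiable functions $u$ of compact support on $\mathbb{C}$ with $u\equiv1$ on $K$. For a bounded open set $U$, $\Gamma_q(U)=\sup\{\Gamma_q(K):K\subset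 U\text{ compact}\}$. *)

theory Defs
  imports "HOL-Analysis.Analysis" "HOL-Computational_Algebra.Polynomial"
begin

definition assoc_fun :: "(real \<Rightarrow> real) \<Rightarrow> real \<Rightarrow> real" where
  "assoc_fun \<phi> r = r / \<phi> r"

definition admissible :: "(real \<Rightarrow> real) \<Rightarrow> bool" where
  "admissible \<phi> \<longleftrightarrow>
     (\<forall>r>0. \<phi> r > 0) \<and> mono_on {0<..} \<phi> \<and>
     (\<forall>r>0. assoc_fun \<phi> r > 0) \<and> mono_on {0<..} (assoc_fun \<phi>) \<and>
     (assoc_fun \<phi> \<longlongrightarrow> 0) (at_right 0)"

(* Admissible functions live on (0,\<infinity>); this fixes the value 0 at the origin. *)
definition ext0 :: "(real \<Rightarrow> real) \<Rightarrow> real \<Rightarrow> real" where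
  "ext0 \<phi> r = (if r = 0 then 0 else \<phi> r)"

definition R0 :: "complex set \<Rightarrow> (complex \<Rightarrow> complex) set" where
  "R0 X = {f. \<exists>a b. (\<forall>z\<in>X. poly b z \<noteq> 0) \<and> b \<noteq> 0 \<and> f = (\<lambda>z. poly a z / poly b z)}"

definition Lp_norm :: "real \<Rightarrow> complex set \<Rightarrow> (complex \<Rightarrow> complex) \<Rightarrow> real" where
  "Lp_norm p X f = (LINT z:X|lebesgue. cmod (f z) powr p) powr (1 / p)"

definition annulus :: "nat \<Rightarrow> complex \<Rightarrow> complex set" where
  "annulus n x = {z. 2 powr (- (real n + 1)) < cmod (z - x) \<and> cmod (z - x) < 2 powr (- real n)}"

(* Measurability is required explicitly because measure is 0 on non-measurable sets. *)
definition full_area_density :: "complex set \<Rightarrow> complex \<Rightarrow> bool" where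
  "full_area_density E x \<longleftrightarrow>
     E \<in> sets lebesgue \<and>
     ((\<lambda>r. measure lebesgue (ball x r - E) / measure lebesgue (ball x r)) \<longlongrightarrow> 0) (at_right 0)"

primrec C_k :: "nat \<Rightarrow> ('a::real_normed_vector \<Rightarrow> 'b::real_normed_vector) \<Rightarrow> bool" where
  "C_k 0 u \<longleftrightarrow> continuous_on UNIV u"
| "C_k (Suc k) u \<longleftrightarrow>
     (\<forall>z. u differentiable (at z)) \<and> (\<forall>v. C_k k (\<lambda>z. frechet_derivative u (at z) v))"

definition test_function :: "(complex \<Rightarrow> real) \<Rightarrow> bool" where
  "test_function u \<longleftrightarrow> (\<forall>k. C_k k u) \<and> compact (closure {z. u z \<noteq> 0})"

(* The gradient (u_x, u_y), with the plane identified with the complex numbers. *)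
definition grad :: "(complex \<Rightarrow> real) \<Rightarrow> complex \<Rightarrow> complex" where
  "grad u z = Complex (frechet_derivative u (at z) 1) (frechet_derivative u (at z) \<i>)"

definition capacity_compact :: "real \<Rightarrow> complex set \<Rightarrow> ennreal" where
  "capacity_compact q K =
     (INF u\<in>{u. test_function u \<and> (\<forall>z\<in>K. u z = 1)}.
        \<integral>\<^sup>+ z. ennreal (cmod (grad u z) powr q) \<partial>lebesgue)"

definition capacity_open :: "real \<Rightarrow> complex set \<Rightarrow> ennreal" where
  "capacity_open q U = (SUP K\<in>{K. compact K \<and> K \<subseteq> U}. capacity_compact q K)"

end

theory Submission
  imports Defs "HOL-Complex_Analysis.Complex_Analysis"
begin

text \<open>
  Remove from the closed unit disk one small disk \<open>ball (c k) (\<rho> k)\<close> per dyadic annulus of a very sparse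
  sequence of annuli, of outer radius \<open>d k\<close>. Up to constants a disk of radius \<open>r\<close> has \<open>q\<close>-capacity
  \<open>r powr (2 - q)\<close>, and the radii are chosen such that the \<open>k\<close>-th hole contributes \<open>1 / (k + 1)\<close> to the
  series, which therefore diverges like the harmonic series. By the residue theorem, \<open>f y - f 0\<close> is an
  integral of \<open>f z * y / (z * (z - y))\<close> over a large circle and circles around the holes, and on those
  circles \<open>f\<close> is controlled pointwise by its \<open>L\<^sup>p\<close> norm. Off disks around the holes of
  radius \<open>o(d k)\<close>, the \<open>k\<close>-th circle contributes at most a factor tending to 0 as \<open>k\<close> grows times
  \<open>\<phi> \<bar>y\<bar>\<close> times the smaller of \<open>\<psi> \<bar>y\<bar> / \<psi> (d k)\<close> and \<open>\<phi> (d k) / \<phi> \<bar>y\<bar>\<close>, and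
  sparseness makes the sum of these quotients uniformly bounded.
\<close>

section \<open>Point evaluations and area integrals\<close>

text \<open>Young's inequality, applied pointwise to \<open>g x / \<sigma>\<close> and
  \<open>1\<close>, is integrated over \<open>A\<close>. Upper bounds \<open>J\<close> and
  \<open>m\<close> in place of exact values suit integrals that are only estimated.\<close>

lemma set_nn_integral_Hoelder:
  fixes g :: "'a \<Rightarrow> real" and s t :: real
  assumes st: "1 < s" "1 < t" "1 / s + 1 / t = 1"
    and [measurable]: "g \<in> borel_measurable M" "A \<in> sets M"
    and g0: "\<And>x. 0 \<le> g x"
    and m: "emeasure M A \<le> ennreal m" "0 \<le> m"
    and J: "(\<integral>\<^sup>+ x\<in>A. ennreal (g x powr s) \<partial>M) \<le> ennreal J" "0 \<le> J"
  shows "(\<integral>\<^sup>+ x\<in>A. ennreal (g x) \<partial>M) \<le> ennreal (J powr (1 / s) * m powr (1 / t))"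
\<comment> \<open>With \<open>x / 0 = 0\<close>, the scale \<open>\<sigma>\<close> chosen below
  would be 0 in these cases; here \<open>g\<close> vanishes almost everywhere on \<open>A\<close>,
  or \<open>A\<close> is a null set.\<close>
proof (cases "J = 0 \<or> m = 0")
  case True
  have "AE x in M. ennreal (g x) * indicator A x = 0"
  proof (cases "J = 0")
    case True
    then have "(\<integral>\<^sup>+ x\<in>A. ennreal (g x powr s) \<partial>M) = 0" using J by simp
    then have "AE x in M. ennreal (g x powr s) * indicator A x = 0"
      by (subst (asm) nn_integral_0_iff_AE) auto
    then show ?thesis
      by eventually_elim (use g0 in \<open>auto split: split_indicator\<close>)
  next
    case False
    then have "A \<in> null_sets M" using True m by auto
    then have "AE x in M. x \<notin> A" by (rule AE_not_in)
    then show ?thesis by eventually_elim auto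
  qed
  then show ?thesis by (subst nn_integral_0_iff_AE[THEN iffD2]) auto
next
  case False
  then have pos: "J > 0" "m > 0" using m J by auto
  \<comment> \<open>This scale balances Young's inequality: \<open>c * J\<close> becomes
    \<open>\<sigma> * m / s\<close>, so the two integrated terms add up to
    \<open>\<sigma> * m\<close>.\<close>
  define \<sigma> where "\<sigma> = (J / m) powr (1 / s)"
  have \<sigma>: "\<sigma> > 0" "\<sigma> powr s = J / m" using pos st by (auto simp: \<sigma>_def powr_powr)
  define c where "c = \<sigma> / (s * (J / m))"
  have c0: "c \<ge> 0" using \<sigma> pos st by (auto simp: c_def)
  have ptw: "g x \<le> c * g x powr s + \<sigma> / t" for x
  proof -
    have "g x / \<sigma> * 1 \<le> (g x / \<sigma>) powr s / s + 1 powr t / t"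
      by (rule Youngs_inequality) (use st g0 \<sigma> in auto)
    then have "g x / \<sigma> \<le> g x powr s / (J / m) / s + 1 / t"
      using g0 \<sigma> by (simp add: powr_divide)
    then have "g x \<le> \<sigma> * (g x powr s / (J / m) / s + 1 / t)"
      using \<sigma> by (simp add: field_simps)
    then show ?thesis by (simp add: c_def algebra_simps)
  qed
  have "(\<integral>\<^sup>+ x\<in>A. ennreal (g x) \<partial>M)
      \<le> (\<integral>\<^sup>+ x. ennreal c * (ennreal (g x powr s) * indicator A x) + ennreal (\<sigma> / t) * indicator A x \<partial>M)"
    using ptw c0 \<sigma> st
    by (intro nn_integral_mono) (auto split: split_indicator simp flip: ennreal_plus ennreal_mult)
  also have "\<dots> = ennreal c * (\<integral>\<^sup>+ x\<in>A. ennreal (g x powr s) \<partial>M) + ennreal (\<sigma> / t) * emeasure M A"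
    by (subst nn_integral_add) (auto simp: nn_integral_cmult)
  also have "\<dots> \<le> ennreal c * ennreal J + ennreal (\<sigma> / t) * ennreal m"
    by (intro add_mono mult_left_mono J m) auto
  also have "\<dots> = ennreal (c * J + \<sigma> / t * m)"
    using c0 pos \<sigma> st by (simp flip: ennreal_plus ennreal_mult)
  also have "c * J + \<sigma> / t * m = \<sigma> * m * (1 / s + 1 / t)"
    using pos by (simp add: c_def field_simps)
  also have "\<dots> = J powr (1 / s) * m powr (1 - 1 / s)"
    using st pos by (simp add: \<sigma>_def powr_divide powr_diff)
  also have "1 - 1 / s = 1 / t" using st by simp
  finally show ?thesis .
qed

lemma emeasure_lborel_ball_complex:
  "r \<ge> 0 \<Longrightarrow> emeasure lborel (ball (z :: complex) r) = ennreal (pi * r\<^sup>2)"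
  by (simp add: emeasure_ball unit_ball_vol_2)

text \<open>The shifted circle stays in \<open>ball z r\<close> and at distance at least
  \<open>r / 4\<close> from \<open>z\<close>. Cauchy's formula divides its radius
  \<open>r / 2\<close> by that distance, hence the factor 2.\<close>

lemma holomorphic_norm_le_circle_integral:
  assumes f: "f holomorphic_on ball z r" and r: "0 < r" and w: "cmod w < r / 4"
  shows "ennreal (cmod (f z)) \<le>
    2 * (\<integral>\<^sup>+ t\<in>{0..1}. ennreal (cmod (f (circlepath (z + w) (r / 2) t))) \<partial>lborel)"
proof -
  let ?g = "circlepath (z + w) (r / 2)"
  let ?F = "\<lambda>t. f (?g t) / (?g t - z) * vector_derivative ?g (at t)"
  have sub: "cball (z + w) (r / 2) \<subseteq> ball z r"
  proof
    fix u assume "u \<in> cball (z + w) (r / 2)"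
    then have "dist z u \<le> cmod w + r / 2"
      using dist_triangle[of z u "z + w"] by (auto simp: dist_norm)
    then show "u \<in> ball z r" using w r by simp
  qed
  have im: "?g t \<in> cball (z + w) (r / 2)" for t
    using r by (auto simp: circlepath dist_norm norm_mult)
  have cont: "continuous_on {0..1} (\<lambda>t. cmod (f (?g t)))"
  proof -
    have "continuous_on {0..1} ?g" unfolding circlepath by (intro continuous_intros)
    moreover have "continuous_on (ball z r) f" using f by (rule holomorphic_on_imp_continuous_on)
    ultimately have "continuous_on {0..1} (\<lambda>t. f (?g t))"
      using im sub by (intro continuous_on_compose2[of "ball z r" f "{0..1}" ?g]) auto
    then show ?thesis by (intro continuous_intros)
  qed
  have "((\<lambda>u. f u / (u - z)) has_contour_integral 2 * of_real pi * \<i> * f z) ?g"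
    by (rule Cauchy_integral_circlepath_simple)
      (use holomorphic_on_subset[OF f sub] w r in auto)
  then have F: "(?F has_integral 2 * of_real pi * \<i> * f z) {0..1}"
    by (simp add: has_contour_integral)
  have I: "((\<lambda>t. cmod (f (?g t))) has_integral integral {0..1} (\<lambda>t. cmod (f (?g t)))) {0..1}"
    using integrable_continuous_real[OF cont] by (rule integrable_integral)
  have bound: "norm (?F t) \<le> 4 * pi * cmod (f (?g t))" for t
  proof -
    have "cmod (?g t - (z + w)) = r / 2"
      using r by (simp add: circlepath norm_mult)
    then have "r / 2 \<le> cmod (?g t - z) + cmod w"
      by (metis add_diff_cancel_left' diff_diff_eq norm_triangle_ineq4)
    then have d: "cmod (?g t - z) \<ge> r / 4" using w by simp
    have "norm (?F t) = cmod (f (?g t)) * (pi * r / cmod (?g t - z))"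
      using r by (simp add: vector_derivative_circlepath norm_mult norm_divide)
    also have "\<dots> \<le> cmod (f (?g t)) * (pi * r / (r / 4))"
      using d r by (intro mult_left_mono divide_left_mono mult_pos_pos) auto
    finally show ?thesis using r by (simp add: mult_ac)
  qed
  have "norm (2 * of_real pi * \<i> * f z) \<le> integral {0..1} (\<lambda>t. 4 * pi * cmod (f (?g t)))"
    unfolding integral_unique[OF F, symmetric]
  proof (rule Henstock_Kurzweil_Integration.integral_norm_bound_integral)
    show "?F integrable_on {0..1}" using F by blast
    show "(\<lambda>t. 4 * pi * cmod (f (?g t))) integrable_on {0..1}"
      by (intro integrable_continuous_real continuous_intros cont)
  qed (rule bound)
  then have "cmod (f z) \<le> 2 * integral {0..1} (\<lambda>t. cmod (f (?g t)))"
    by (simp add: norm_mult)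
  then have "ennreal (cmod (f z)) \<le> 2 * ennreal (integral {0..1} (\<lambda>t. cmod (f (?g t))))"
    by (metis ennreal_leI ennreal_mult' ennreal_numeral zero_le_numeral)
  also have "ennreal (integral {0..1} (\<lambda>t. cmod (f (?g t))))
      = (\<integral>\<^sup>+ t\<in>{0..1}. ennreal (cmod (f (?g t))) \<partial>lborel)"
    by (subst nn_integral_has_integral_lebesgue[OF _ I, symmetric])
      (auto intro!: nn_integral_cong split: split_indicator)
  finally show ?thesis .
qed

text \<open>
  Averaging Cauchy's formula over translated circles instead of over concentric ones needs only
  the translation invariance of the area measure, no polar coordinates.
\<close>

lemma holomorphic_norm_le_area_integral:
  assumes f: "f holomorphic_on ball z r" and r: "0 < r"
    and [measurable]: "f \<in> borel_measurable borel"
  shows "ennreal (cmod (f z) * (pi * r\<^sup>2 / 32)) \<le> (\<integral>\<^sup>+ w\<in>ball z r. ennreal (cmod (f w)) \<partial>lborel)"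
    (is "_ \<le> ?I")
proof -
  let ?c = "\<lambda>t. z + of_real (r / 2) * exp (2 * of_real pi * \<i> * of_real t)"
  have cm[measurable]: "?c \<in> borel_measurable borel"
    by (intro borel_measurable_continuous_onI continuous_intros)
  have [measurable]: "ball (0::complex) (r / 4) \<in> sets borel" "ball z r \<in> sets borel" by simp_all
  let ?h = "\<lambda>w t. ennreal (cmod (f (?c t + w))) * indicator {0..1} t * indicator (ball 0 (r / 4)) w"
  \<comment> \<open>The shifts \<open>w\<close> fill a disk of area
    \<open>pi * r\<^sup>2 / 16\<close>; the factor 2 of the circle estimate turns 16 into
    32.\<close>
  have "ennreal (cmod (f z) * (pi * r\<^sup>2 / 16))
      = (\<integral>\<^sup>+ w\<in>ball (0::complex) (r / 4). ennreal (cmod (f z)) \<partial>lborel)"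
  proof -
    have "emeasure lborel (ball (0::complex) (r / 4)) = ennreal (pi * r\<^sup>2 / 16)"
      using emeasure_lborel_ball_complex[of "r / 4" 0] r by (simp add: power_divide)
    then show ?thesis
      by (simp add: nn_integral_cmult_indicator ennreal_mult'[symmetric])
  qed
  also have "\<dots> \<le> (\<integral>\<^sup>+ w. \<integral>\<^sup>+ t. 2 * ?h w t \<partial>lborel \<partial>lborel)"
  proof (rule nn_integral_mono)
    fix w :: complex
    show "ennreal (cmod (f z)) * indicator (ball 0 (r / 4)) w \<le> (\<integral>\<^sup>+ t. 2 * ?h w t \<partial>lborel)"
      using holomorphic_norm_le_circle_integral[OF f r, of w]
      by (cases "w \<in> ball 0 (r / 4)") (simp_all add: nn_integral_cmult circlepath add_ac)
  qed
  also have "\<dots> = (\<integral>\<^sup>+ t. \<integral>\<^sup>+ w. 2 * ?h w t \<partial>lborel \<partial>lborel)"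
    by (rule lborel_pair.Fubini'[symmetric]) measurable
  also have "\<dots> \<le> (\<integral>\<^sup>+ t. 2 * ?I * indicator {0..1::real} t \<partial>lborel)"
  proof (rule nn_integral_mono)
    fix t :: real
    have nc: "cmod (of_real (r / 2) * exp (2 * of_real pi * \<i> * of_real t)) = r / 2"
      using r by (simp add: norm_mult)
    have sub: "?c t + w \<in> ball z r" if "cmod w < r / 4" for w
    proof -
      have "dist (?c t + w) z \<le> r / 2 + cmod w"
        using norm_triangle_ineq[of "of_real (r / 2) * exp (2 * of_real pi * \<i> * of_real t)" w]
        unfolding nc by (simp add: dist_norm)
      then show ?thesis using that r by (simp add: dist_commute)
    qed
    \<comment> \<open>For fixed \<open>t\<close> the translated disk lies in
      \<open>ball z r\<close>, so the bound obtained does not depend on \<open>t\<close>.\<close>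
    have "(\<integral>\<^sup>+ w. ennreal (cmod (f (?c t + w))) * indicator (ball 0 (r / 4)) w \<partial>lborel)
        \<le> (\<integral>\<^sup>+ w. ennreal (cmod (f (?c t + w))) * indicator (ball z r) (?c t + w) \<partial>lborel)"
      using sub by (intro nn_integral_mono) (auto split: split_indicator)
    also have "\<dots> = (\<integral>\<^sup>+ w. ennreal (cmod (f w)) * indicator (ball z r) w \<partial>distr lborel borel ((+) (?c t)))"
      by (subst nn_integral_distr) auto
    also have "\<dots> = ?I" by (simp add: lborel_distr_plus)
    finally show "(\<integral>\<^sup>+ w. 2 * ?h w t \<partial>lborel) \<le> 2 * ?I * indicator {0..1} t"
      by (auto simp: nn_integral_cmult mult_left_mono split: split_indicator)
  qed
  also have "\<dots> = 2 * ?I" by (simp add: nn_integral_cmult_indicator)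
  finally have "ennreal (cmod (f z) * (pi * r\<^sup>2 / 16)) \<le> 2 * ?I" .
  also have "cmod (f z) * (pi * r\<^sup>2 / 16) = 2 * (cmod (f z) * (pi * r\<^sup>2 / 32))"
    by (simp add: field_simps)
  also have "ennreal \<dots> = 2 * ennreal (cmod (f z) * (pi * r\<^sup>2 / 32))"
    by (subst ennreal_mult') simp_all
  finally show ?thesis
    by (simp add: ennreal_mult_le_mult_iff)
qed

section \<open>Capacity of a disk\<close>

lemma nn_integral_lborel_affine_complex:
  fixes F :: "complex \<Rightarrow> ennreal"
  assumes "\<tau> > 0" and [measurable]: "F \<in> borel_measurable borel"
  shows "(\<integral>\<^sup>+ w. F (x + of_real \<tau> * w) \<partial>lborel) = ennreal (\<tau> powr - 2) * (\<integral>\<^sup>+ z. F z \<partial>lborel)"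
proof -
  have "(\<integral>\<^sup>+ z. F z \<partial>lborel)
      = (\<integral>\<^sup>+ z. F z \<partial>density (distr lborel borel (\<lambda>z. x + \<tau> *\<^sub>R z)) (\<lambda>_. ennreal (\<bar>\<tau>\<bar> ^ DIM(complex))))"
    using lborel_affine[of \<tau> x] assms by simp
  also have "\<dots> = ennreal (\<tau>\<^sup>2) * (\<integral>\<^sup>+ w. F (x + of_real \<tau> * w) \<partial>lborel)"
    by (simp add: nn_integral_density nn_integral_distr nn_integral_cmult scaleR_conv_of_real)
  finally have "ennreal (\<tau> powr - 2) * (\<integral>\<^sup>+ z. F z \<partial>lborel)
      = ennreal (\<tau> powr - 2 * \<tau>\<^sup>2) * (\<integral>\<^sup>+ w. F (x + of_real \<tau> * w) \<partial>lborel)"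
    by (simp add: ennreal_mult mult.assoc)
  also have "\<tau> powr - 2 * \<tau>\<^sup>2 = 1"
    using assms by (simp add: powr_minus powr_numeral)
  finally show ?thesis by simp
qed

text \<open>In real coordinates the derivative is the inner product with \<open>grad u z\<close>, so
  the last claim is Cauchy-Schwarz.\<close>

lemma test_function_grad:
  assumes "test_function u"
  shows "u differentiable (at z)"
    and "continuous_on UNIV (grad u)"
    and "\<bar>frechet_derivative u (at z) w\<bar> \<le> cmod (grad u z) * cmod w"
proof -
  have C: "C_k (Suc 0) u" using assms by (auto simp: test_function_def simp del: C_k.simps)
  then have d: "u differentiable (at z)" for z by simp
  then show "u differentiable (at z)" .
  show "continuous_on UNIV (grad u)"
    using C unfolding grad_def Complex_eq by (intro continuous_intros) simp_all
  have lin: "linear (frechet_derivative u (at z))"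
    using d[of z] unfolding frechet_derivative_works by (rule has_derivative_linear)
  have "w = Re w *\<^sub>R 1 + Im w *\<^sub>R \<i>" by (simp add: complex_eq_iff)
  then have "frechet_derivative u (at z) w = frechet_derivative u (at z) (Re w *\<^sub>R 1 + Im w *\<^sub>R \<i>)"
    by (rule arg_cong)
  also have "\<dots> = grad u z \<bullet> w"
    by (simp only: linear_add[OF lin] linear_cmul[OF lin]) (simp add: grad_def inner_complex_def)
  finally show "\<bar>frechet_derivative u (at z) w\<bar> \<le> cmod (grad u z) * cmod w"
    by (simp add: Cauchy_Schwarz_ineq2)
qed

text \<open>Along the ray from \<open>x\<close> through \<open>x + w\<close>, \<open>u\<close> drops
  from 1 to 0 because its support is bounded; the fundamental theorem of calculus bounds this drop
  by the integral of the gradient.\<close>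

lemma test_function_ray:
  assumes u: "test_function u" and u1: "u (x + w) = 1" and w: "w \<noteq> 0"
  shows "1 \<le> (\<integral>\<^sup>+ \<tau>\<in>{1..}. ennreal (cmod (grad u (x + of_real \<tau> * w)) * cmod w) \<partial>lborel)"
proof -
  let ?v = "\<lambda>\<tau>::real. u (x + of_real \<tau> * w)"
  let ?v' = "\<lambda>\<tau>. frechet_derivative u (at (x + of_real \<tau> * w)) w"
  let ?G = "\<lambda>\<tau>::real. cmod (grad u (x + of_real \<tau> * w)) * cmod w"
  have "bounded {z. u z \<noteq> 0}"
    using u unfolding test_function_def by (metis bounded_subset closure_subset compact_imp_bounded)
  then obtain R where R: "\<And>z. u z \<noteq> 0 \<Longrightarrow> cmod z \<le> R"
    unfolding bounded_iff by auto
  \<comment> \<open>At this parameter the ray is outside the disk of radius \<open>R\<close> holding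
    all nonzeros of \<open>u\<close>; the maximum guarantees \<open>1 \<le> T\<close>.\<close>
  define T where "T = max 1 ((\<bar>R\<bar> + cmod x + 1) / cmod w)"
  have "T * cmod w \<ge> \<bar>R\<bar> + cmod x + 1"
    using w by (simp add: T_def max_def field_simps)
  moreover have "T * cmod w \<le> cmod (x + of_real T * w) + cmod x"
    using norm_triangle_ineq4[of "x + of_real T * w" x] by (simp add: norm_mult T_def)
  ultimately have uT: "?v T = 0" using R[of "x + of_real T * w"] by fastforce
  have T: "1 \<le> T" by (simp add: T_def)
  have deriv: "(?v has_vector_derivative ?v' \<tau>) (at \<tau> within {1..T})" for \<tau>
  proof -
    let ?z = "x + of_real \<tau> * w"
    have Du: "(u has_derivative frechet_derivative u (at ?z)) (at ?z)"
      using test_function_grad(1)[OF u] by (simp add: frechet_derivative_works)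
    have "((\<lambda>\<tau>. x + of_real \<tau> * w) has_derivative (\<lambda>h. of_real h * w)) (at \<tau>)"
      by (auto intro!: derivative_eq_intros)
    from diff_chain_at[OF this Du]
    have "(?v has_derivative (\<lambda>h. frechet_derivative u (at ?z) (of_real h * w))) (at \<tau>)"
      by (simp add: o_def)
    moreover have "linear (frechet_derivative u (at ?z))"
      using Du by (rule has_derivative_linear)
    then have "frechet_derivative u (at ?z) (of_real h * w) = h *\<^sub>R ?v' \<tau>" for h
      by (metis linear_cmul scaleR_conv_of_real)
    ultimately show ?thesis
      by (simp add: has_vector_derivative_def has_derivative_at_withinI)
  qed
  have I: "(?v' has_integral ?v T - ?v 1) {1..T}"
    by (rule fundamental_theorem_of_calculus[OF T deriv])
  have cont: "continuous_on {1..T} ?G"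
    by (intro continuous_intros continuous_on_compose2[OF test_function_grad(2)[OF u]]) auto
  then have IG: "(?G has_integral integral {1..T} ?G) {1..T}"
    by (intro integrable_integral integrable_continuous_real)
  have "norm (integral {1..T} ?v') \<le> integral {1..T} ?G"
    using I IG test_function_grad(3)[OF u]
    by (intro Henstock_Kurzweil_Integration.integral_norm_bound_integral) auto
  then have "1 \<le> integral {1..T} ?G"
    using integral_unique[OF I] uT u1 by simp
  then have "1 \<le> ennreal (integral {1..T} ?G)" by simp
  also have "\<dots> = (\<integral>\<^sup>+ \<tau>. ennreal (indicator {1..T} \<tau> * ?G \<tau>) \<partial>lborel)"
    by (rule nn_integral_has_integral_lebesgue[OF _ IG, symmetric]) auto
  also have "\<dots> \<le> (\<integral>\<^sup>+ \<tau>\<in>{1..}. ennreal (?G \<tau>) \<partial>lborel)"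
    by (intro nn_integral_mono) (auto split: split_indicator)
  finally show ?thesis .
qed

text \<open>
  Averaging \<open>test_function_ray\<close> over \<open>w \<in> ball 0 r\<close> and applying Hoelder's inequality on each dilated disk
  leaves the integral of \<open>\<tau> powr (- 2 / q)\<close> over \<open>{1..}\<close>, which is finite because \<open>q < 2\<close>.
\<close>

lemma capacity_compact_cball_ge:
  assumes p: "2 < p" and q: "q = p / (p - 1)" and r: "0 < r"
  shows "ennreal (pi * (1 - 2 / p) powr q * r powr (2 - q)) \<le> capacity_compact q (cball x r)"
  unfolding capacity_compact_def
proof (rule INF_greatest)
  fix u assume "u \<in> {u. test_function u \<and> (\<forall>z\<in>cball x r. u z = 1)}"
  then have u: "test_function u" and u1: "\<And>z. z \<in> cball x r \<Longrightarrow> u z = 1" by auto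
  have qp: "1 < q" "q < 2" "1 / q + 1 / p = 1"
    using p by (auto simp: q field_simps)
  let ?G = "\<lambda>z. cmod (grad u z)"
  let ?J = "\<integral>\<^sup>+ z. ennreal (?G z powr q) \<partial>lborel"
  have [measurable]: "grad u \<in> borel_measurable borel"
    by (rule borel_measurable_continuous_onI[OF test_function_grad(2)[OF u]])
  have [measurable]: "ball (0::complex) r \<in> sets borel" by simp
  have "ennreal (pi * (1 - 2 / p) powr q * r powr (2 - q)) \<le> ?J"
  proof (cases ?J rule: ennreal_cases)
    case (real j)
    define A where "A = j powr (1 / q) * (pi * r\<^sup>2) powr (1 / p)"
    have A0: "A \<ge> 0" by (simp add: A_def)
    \<comment> \<open>Undoing the dilation by \<open>\<tau>\<close> costs a factor
      \<open>\<tau> powr - 2\<close> in the integral of the \<open>q\<close>-th power; its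
      \<open>q\<close>-th root gives the exponent \<open>- 2 / q\<close>.\<close>
    have inner: "(\<integral>\<^sup>+ w\<in>ball 0 r. ennreal (?G (x + of_real \<tau> * w)) \<partial>lborel) \<le> ennreal (A * \<tau> powr (- 2 / q))"
      if "1 \<le> \<tau>" for \<tau>
    proof -
      have "(\<integral>\<^sup>+ w\<in>ball 0 r. ennreal (?G (x + of_real \<tau> * w) powr q) \<partial>lborel)
          \<le> (\<integral>\<^sup>+ w. ennreal (?G (x + of_real \<tau> * w) powr q) \<partial>lborel)"
        by (intro nn_integral_mono) (auto split: split_indicator)
      also have "\<dots> = ennreal (\<tau> powr - 2) * ?J"
        using that by (subst nn_integral_lborel_affine_complex) auto
      also have "\<dots> = ennreal (\<tau> powr - 2 * j)"
        using real by (simp add: ennreal_mult)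
      finally have "(\<integral>\<^sup>+ w\<in>ball 0 r. ennreal (?G (x + of_real \<tau> * w)) \<partial>lborel)
          \<le> ennreal ((\<tau> powr - 2 * j) powr (1 / q) * (pi * r\<^sup>2) powr (1 / p))"
        using r real p qp emeasure_lborel_ball_complex[of r 0]
        by (intro set_nn_integral_Hoelder[where s = q and t = p]) auto
      also have "(\<tau> powr - 2 * j) powr (1 / q) * (pi * r\<^sup>2) powr (1 / p) = A * \<tau> powr (- 2 / q)"
        using that real by (simp add: A_def powr_mult powr_powr)
      finally show ?thesis .
    qed
    have "ennreal (pi * r\<^sup>2) = (\<integral>\<^sup>+ w. indicator (ball (0::complex) r) w \<partial>lborel)"
      using emeasure_lborel_ball_complex[of r 0] r by simp
    also have "\<dots> \<le> (\<integral>\<^sup>+ w. \<integral>\<^sup>+ \<tau>. ennreal r * (ennreal (?G (x + of_real \<tau> * w)) * indicator (ball 0 r) w) * indicator {1..} \<tau> \<partial>lborel \<partial>lborel)"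
    proof (rule nn_integral_mono_AE)
      \<comment> \<open>For \<open>w = 0\<close> the ray degenerates to a point, so this null set is
        discarded.\<close>
      have "AE w in lborel. w \<noteq> (0::complex)"
        by (rule AE_lborel_singleton)
      then show "AE w in lborel. indicator (ball 0 r) w \<le>
          (\<integral>\<^sup>+ \<tau>. ennreal r * (ennreal (?G (x + of_real \<tau> * w)) * indicator (ball 0 r) w) * indicator {1..} \<tau> \<partial>lborel)"
      proof eventually_elim
        case (elim w)
        show ?case
        proof (cases "w \<in> ball 0 r")
          case True
          then have "1 \<le> (\<integral>\<^sup>+ \<tau>\<in>{1..}. ennreal (?G (x + of_real \<tau> * w) * cmod w) \<partial>lborel)"
            by (intro test_function_ray[OF u _ elim] u1) (auto simp: dist_norm)
          also have "\<dots> \<le> (\<integral>\<^sup>+ \<tau>\<in>{1..}. ennreal r * ennreal (?G (x + of_real \<tau> * w)) \<partial>lborel)"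
            using True r mult_left_mono[of "cmod w" r]
            by (intro nn_integral_mono mult_right_mono)
              (auto simp: mult.commute[of r] simp flip: ennreal_mult' intro!: ennreal_leI)
          finally show ?thesis using True by simp
        qed simp
      qed
    qed
    also have "\<dots> = (\<integral>\<^sup>+ \<tau>. \<integral>\<^sup>+ w. ennreal r * (ennreal (?G (x + of_real \<tau> * w)) * indicator (ball 0 r) w) * indicator {1..} \<tau> \<partial>lborel \<partial>lborel)"
      by (rule lborel_pair.Fubini'[symmetric]) measurable
    also have "\<dots> \<le> (\<integral>\<^sup>+ \<tau>. ennreal (r * A) * (ennreal (\<tau> powr (- 2 / q)) * indicator {1..} \<tau>) \<partial>lborel)"
    proof (rule nn_integral_mono)
      fix \<tau> :: real
      show "(\<integral>\<^sup>+ w. ennreal r * (ennreal (?G (x + of_real \<tau> * w)) * indicator (ball 0 r) w) * indicator {1..} \<tau> \<partial>lborel)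
        \<le> ennreal (r * A) * (ennreal (\<tau> powr (- 2 / q)) * indicator {1..} \<tau>)"
      proof (cases "1 \<le> \<tau>")
        case True
        then have "ennreal r * (\<integral>\<^sup>+ w\<in>ball 0 r. ennreal (?G (x + of_real \<tau> * w)) \<partial>lborel)
            \<le> ennreal r * ennreal (A * \<tau> powr (- 2 / q))"
          by (intro mult_left_mono inner) auto
        then show ?thesis
          using True A0 r by (simp add: nn_integral_cmult ennreal_mult mult.assoc)
      qed simp
    qed
    also have "\<dots> = ennreal (r * A) * (\<integral>\<^sup>+ \<tau>. ennreal (\<tau> powr (- 2 / q)) * indicator {1..} \<tau> \<partial>lborel)"
      by (simp add: nn_integral_cmult)
    \<comment> \<open>As \<open>1 / q + 1 / p = 1\<close>, the exponent is
      \<open>- (1 - 2 / p) - 1\<close>, and the integral equals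
      \<open>1 / (1 - 2 / p)\<close>.\<close>
    also have "(\<integral>\<^sup>+ \<tau>. ennreal (\<tau> powr (- 2 / q)) * indicator {1..} \<tau> \<partial>lborel)
        = ennreal (0 - (- 1 / (1 - 2 / p)) * 1 powr (- (1 - 2 / p)))"
    proof (rule nn_integral_FTC_atLeast[where F = "\<lambda>\<tau>. - 1 / (1 - 2 / p) * \<tau> powr - (1 - 2 / p)"])
      fix \<tau> :: real assume "1 \<le> \<tau>"
      have "2 / p = 2 * (1 / p)" "- 2 / q = - 2 * (1 / q)" by simp_all
      then have e: "- (1 - 2 / p) - 1 = - 2 / q" using qp(3) by linarith
      have cancel: "- 1 / c * (- c * v) = v" if "c \<noteq> 0" for c v :: real using that by simp
      have "- 1 / (1 - 2 / p) * (- (1 - 2 / p) * \<tau> powr (- (1 - 2 / p) - 1)) = \<tau> powr (- 2 / q)"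
        unfolding e by (rule cancel) (use p in simp)
      then show "((\<lambda>\<tau>. - 1 / (1 - 2 / p) * \<tau> powr - (1 - 2 / p)) has_real_derivative \<tau> powr (- 2 / q)) (at \<tau>)"
        using \<open>1 \<le> \<tau>\<close> by (intro DERIV_cong[OF DERIV_cmult[OF has_real_derivative_powr]]) auto
    next
      have "((\<lambda>\<tau>. \<tau> powr - (1 - 2 / p)) \<longlongrightarrow> 0) at_top"
        using p by (intro tendsto_neg_powr filterlim_ident) auto
      then show "((\<lambda>\<tau>. - 1 / (1 - 2 / p) * \<tau> powr - (1 - 2 / p)) \<longlongrightarrow> 0) at_top"
        by (rule tendsto_mult_right_zero)
    qed auto
    also have "ennreal (r * A) * \<dots> = ennreal (r * A / (1 - 2 / p))"
      using r A0 p by (simp flip: ennreal_mult)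
    finally have "pi * r\<^sup>2 \<le> r * A / (1 - 2 / p)"
      using r A0 p by (subst (asm) ennreal_le_iff) auto
    then have "(1 - 2 / p) * (pi * r\<^sup>2) \<le> r * A" using p by (simp add: field_simps)
    \<comment> \<open>The factor \<open>(pi * r\<^sup>2) powr (1 / p)\<close> contained in
      \<open>A\<close> is cancelled; raising to the power \<open>q\<close> then isolates
      \<open>j\<close>.\<close>
    then have "(1 - 2 / p) * (pi * r\<^sup>2) powr (1 / q) \<le> r * j powr (1 / q)"
    proof -
      have "1 / q = 1 - 1 / p" using qp by simp
      then have "(pi * r\<^sup>2) powr (1 / q) * (pi * r\<^sup>2) powr (1 / p) = pi * r\<^sup>2"
        using r by (simp flip: powr_add)
      moreover assume "(1 - 2 / p) * (pi * r\<^sup>2) \<le> r * A"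
      ultimately have "((1 - 2 / p) * (pi * r\<^sup>2) powr (1 / q)) * (pi * r\<^sup>2) powr (1 / p)
          \<le> (r * j powr (1 / q)) * (pi * r\<^sup>2) powr (1 / p)"
        by (simp add: A_def mult.assoc)
      then show ?thesis using r by (simp add: mult_le_cancel_right)
    qed
    then have "((1 - 2 / p) * (pi * r\<^sup>2) powr (1 / q)) powr q \<le> (r * j powr (1 / q)) powr q"
      using p qp by (intro powr_mono2) auto
    then have "(1 - 2 / p) powr q * (pi * r\<^sup>2) \<le> r powr q * j"
      using p qp r real by (simp add: powr_mult powr_powr)
    then have "(1 - 2 / p) powr q * (pi * r\<^sup>2) / r powr q \<le> j"
      using r by (simp add: field_simps)
    also have "(1 - 2 / p) powr q * (pi * r\<^sup>2) / r powr q = pi * (1 - 2 / p) powr q * r powr (2 - q)"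
      using r by (simp add: powr_diff powr_numeral)
    finally show ?thesis using real by (simp add: ennreal_leI)
  qed simp
  then show "ennreal (pi * (1 - 2 / p) powr q * r powr (2 - q))
      \<le> (\<integral>\<^sup>+ z. ennreal (?G z powr q) \<partial>lebesgue)"
    by (simp add: nn_integral_completion)
qed

section \<open>Rational functions\<close>

text \<open>\<open>P\<close> is the zero set of the denominator. Division by zero yields 0 there, so
  \<open>f\<close> is total and Borel measurable on the whole plane.\<close>

lemma R0_E:
  assumes "f \<in> R0 X"
  obtains P where "finite P" "P \<inter> X = {}" "f holomorphic_on - P" "f \<in> borel_measurable borel"
proof -
  obtain a b where b: "\<forall>z\<in>X. poly b z \<noteq> 0" "b \<noteq> 0" and f: "f = (\<lambda>z. poly a z / poly b z)"
    using assms by (auto simp: R0_def)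
  show ?thesis
  proof
    show "finite {z. poly b z = 0}" using b by (simp add: poly_roots_finite)
    show "{z. poly b z = 0} \<inter> X = {}" using b by auto
    show "f holomorphic_on - {z. poly b z = 0}" unfolding f by (intro holomorphic_intros) auto
    have "poly c \<in> borel_measurable borel" for c :: "complex poly"
      by (intro borel_measurable_continuous_onI continuous_intros)
    then show "f \<in> borel_measurable borel" unfolding f by measurable
  qed
qed

lemma R0_continuous_on:
  assumes "f \<in> R0 X"
  shows "continuous_on X f"
  using assms by (auto simp: R0_def intro!: continuous_intros)

lemma Lp_norm_nonneg: "0 \<le> Lp_norm p X f"
  by (simp add: Lp_norm_def)

text \<open>The area estimate on \<open>ball z r\<close> is followed by Hoelder's inequality for
  \<open>p\<close> and its conjugate \<open>t\<close>; dividing by the area leaves the power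
  \<open>1 / t - 1 = - 1 / p\<close> of it.\<close>

lemma R0_norm_le_Lp_norm:
  assumes X: "compact X" and sub: "ball z r \<subseteq> X" and r: "0 < r" and f: "f \<in> R0 X" and p: "1 < p"
  shows "cmod (f z) \<le> 32 * (pi * r\<^sup>2) powr (- 1 / p) * Lp_norm p X f"
proof -
  obtain P where P: "P \<inter> X = {}" "f holomorphic_on - P" and [measurable]: "f \<in> borel_measurable borel"
    using R0_E[OF f] by metis
  define J where "J = (LINT z:X|lebesgue. cmod (f z) powr p)"
  \<comment> \<open>Integrability makes the integral in \<open>Lp_norm\<close> a genuine one and not
    the default value 0.\<close>
  have "set_integrable lborel X (\<lambda>z. cmod (f z) powr p)"
    unfolding set_integrable_def using p
    by (intro borel_integrable_compact X continuous_intros continuous_on_powr' R0_continuous_on f) auto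
  then have int: "integrable lborel (\<lambda>z. indicator X z *\<^sub>R cmod (f z) powr p)"
    unfolding set_integrable_def .
  have "J = (LINT z|lborel. indicator X z *\<^sub>R cmod (f z) powr p)"
    unfolding J_def set_lebesgue_integral_def using int by (intro integral_completion) auto
  then have J: "(\<integral>\<^sup>+ z. ennreal (indicator X z *\<^sub>R cmod (f z) powr p) \<partial>lborel) = ennreal J"
    using nn_integral_eq_integral[OF int] by auto
  have J0: "0 \<le> J"
    unfolding J_def set_lebesgue_integral_def by (intro integral_nonneg_AE) auto
  define t where "t = p / (p - 1)"
  have t: "1 < t" "1 / p + 1 / t = 1" using p by (auto simp: t_def field_simps)
  have "ennreal (cmod (f z) * (pi * r\<^sup>2 / 32)) \<le> (\<integral>\<^sup>+ w\<in>ball z r. ennreal (cmod (f w)) \<partial>lborel)"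
    using P sub by (intro holomorphic_norm_le_area_integral r holomorphic_on_subset[OF P(2)]) auto
  also have "\<dots> \<le> ennreal (J powr (1 / p) * (pi * r\<^sup>2) powr (1 / t))"
  proof (rule set_nn_integral_Hoelder)
    have "(\<integral>\<^sup>+ w\<in>ball z r. ennreal (cmod (f w) powr p) \<partial>lborel)
        \<le> (\<integral>\<^sup>+ z. ennreal (indicator X z *\<^sub>R cmod (f z) powr p) \<partial>lborel)"
      using sub by (intro nn_integral_mono) (auto split: split_indicator)
    then show "(\<integral>\<^sup>+ w\<in>ball z r. ennreal (cmod (f w) powr p) \<partial>lborel) \<le> ennreal J"
      by (simp only: J)
  qed (use p t J0 r emeasure_lborel_ball_complex[of r z] in auto)
  finally have "cmod (f z) * (pi * r\<^sup>2 / 32) \<le> J powr (1 / p) * (pi * r\<^sup>2) powr (1 / t)"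
    by (subst (asm) ennreal_le_iff) auto
  also have "1 / t = 1 + - 1 / p" using t by simp
  also have "(pi * r\<^sup>2) powr (1 + - 1 / p) = pi * r\<^sup>2 * (pi * r\<^sup>2) powr (- 1 / p)"
    unfolding powr_add using r by simp
  finally have "(pi * r\<^sup>2) * cmod (f z) \<le> (pi * r\<^sup>2) * (32 * (pi * r\<^sup>2) powr (- 1 / p) * J powr (1 / p))"
    by (simp add: mult_ac)
  moreover have "pi * r\<^sup>2 > 0" using r by simp
  ultimately have "cmod (f z) \<le> 32 * (pi * r\<^sup>2) powr (- 1 / p) * J powr (1 / p)"
    by (simp only: mult_le_cancel_left_pos)
  then show ?thesis by (simp add: Lp_norm_def J_def)
qed

section \<open>Residues and contour integrals of rational functions\<close>

text \<open>The circle winds once around the points of \<open>Q\<close> inside it and not at all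
  around the others.\<close>

lemma circlepath_residue_theorem:
  assumes Q: "finite Q" "h holomorphic_on - Q" "Q \<inter> sphere c \<rho> = {}" and \<rho>: "0 < \<rho>"
  shows "contour_integral (circlepath c \<rho>) h = 2 * pi * \<i> * (\<Sum>z\<in>Q \<inter> ball c \<rho>. residue h z)"
proof -
  have "contour_integral (circlepath c \<rho>) h
      = 2 * pi * \<i> * (\<Sum>z\<in>Q. winding_number (circlepath c \<rho>) z * residue h z)"
    using assms by (intro Residue_theorem[where S = UNIV]) (auto simp: Compl_eq_Diff_UNIV)
  also have "(\<Sum>z\<in>Q. winding_number (circlepath c \<rho>) z * residue h z) = (\<Sum>z\<in>Q \<inter> ball c \<rho>. residue h z)"
  proof (rule sum.mono_neutral_cong_right)
    show "\<forall>z\<in>Q - Q \<inter> ball c \<rho>. winding_number (circlepath c \<rho>) z * residue h z = 0"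
    proof
      fix z assume "z \<in> Q - Q \<inter> ball c \<rho>"
      then have "z \<notin> cball c \<rho>" using Q(3) by auto
      then have "winding_number (circlepath c \<rho>) z = 0"
        using \<rho> by (intro winding_number_zero_outside[of _ "cball c \<rho>"]) auto
      then show "winding_number (circlepath c \<rho>) z * residue h z = 0" by simp
    qed
    show "winding_number (circlepath c \<rho>) z * residue h z = residue h z" if "z \<in> Q \<inter> ball c \<rho>" for z
      using that by (subst winding_number_circlepath) (auto simp: dist_norm norm_minus_commute)
  qed (use Q in auto)
  finally show ?thesis .
qed

text \<open>As \<open>y / (z * (z - y)) = 1 / (z - y) - 1 / z\<close>, \<open>h\<close> has residues
  \<open>f y\<close> at \<open>y\<close> and \<open>- f 0\<close> at 0. All other singularities
  inside the large circle lie in holes, and the small circles subtract their residues.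
  \<open>S\<close> indexes the finitely many holes that contain any.\<close>

lemma R0_difference_eq_contour_integrals:
  fixes c :: "nat \<Rightarrow> complex" and \<rho> :: "nat \<Rightarrow> real"
  assumes X: "X = cball 0 1 - (\<Union>k. ball (c k) (\<rho> k))"
    and \<rho>: "\<And>k. 0 < \<rho> k"
    and disj: "\<And>k l. k \<noteq> l \<Longrightarrow> ball (c k) (3 * \<rho> k) \<inter> ball (c l) (3 * \<rho> l) = {}"
    and inner: "\<And>k. ball (c k) (3 * \<rho> k) \<subseteq> ball 0 (1 / 2) - {0, y}"
    and y: "y \<noteq> 0" "cmod y < 1 / 2"
    and f: "f \<in> R0 X"
  defines "h \<equiv> \<lambda>z. f z * y / (z * (z - y))"
  shows "\<exists>S. finite S \<and> 2 * pi * \<i> * (f y - f 0) =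
    contour_integral (circlepath 0 (3 / 4)) h - (\<Sum>k\<in>S. contour_integral (circlepath (c k) (2 * \<rho> k)) h)"
proof -
  obtain P where P: "finite P" "P \<inter> X = {}" "f holomorphic_on - P"
    using R0_E[OF f] by metis
  define Q where "Q = P \<union> {0, y}"
  define P' where "P' = P \<inter> ball 0 (3 / 4)"
  have mono: "ball (c k) (\<rho> k) \<subseteq> ball (c k) (3 * \<rho> k)" "ball (c k) (2 * \<rho> k) \<subseteq> ball (c k) (3 * \<rho> k)" for k
    using \<rho>[of k] by (auto intro: subset_ball)
  have hole: "\<exists>k. z \<in> ball (c k) (\<rho> k)" if "z \<in> P" "cmod z \<le> 1" for z
    using that P(2) by (auto simp: X)
  \<comment> \<open>The tripled disks are disjoint, so a point of \<open>P\<close> in the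
    \<open>k\<close>-th one lies in the \<open>k\<close>-th hole itself and the circle of radius
    \<open>2 * \<rho> k\<close> avoids \<open>P\<close>.\<close>
  have hole_ball: "z \<in> ball (c k) (\<rho> k)" if "z \<in> P" "z \<in> ball (c k) (3 * \<rho> k)" for z k
  proof -
    have "cmod z \<le> 1" using inner[of k] that(2) by force
    then have "\<exists>l. z \<in> ball (c l) (\<rho> l)" using hole that(1) by blast
    then obtain l where l: "z \<in> ball (c l) (\<rho> l)" ..
    then have "l = k" using disj[of l k] mono(1)[of l] that(2) by blast
    then show ?thesis using l by simp
  qed
  have "\<forall>z\<in>P'. \<exists>k. z \<in> ball (c k) (\<rho> k)" using hole by (auto simp: P'_def)
  then obtain \<kappa> where \<kappa>: "\<And>z. z \<in> P' \<Longrightarrow> z \<in> ball (c (\<kappa> z)) (\<rho> (\<kappa> z))" by metis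
  define S where "S = \<kappa> ` P'"
  have finS: "finite S" using P by (simp add: S_def P'_def)
  have "0 \<notin> ball (c k) (\<rho> k)" "y \<notin> ball (c k) (\<rho> k)" for k using inner mono(1) by blast+
  then have X0y: "0 \<in> X" "y \<in> X" using y unfolding X by auto
  have finQ: "finite Q" using P by (simp add: Q_def)
  have hol: "h holomorphic_on - Q"
    unfolding h_def Q_def by (intro holomorphic_intros holomorphic_on_subset[OF P(3)]) auto
  have c1: "contour_integral (circlepath 0 (3 / 4)) h = 2 * pi * \<i> * (\<Sum>z\<in>Q \<inter> ball 0 (3 / 4). residue h z)"
  proof (rule circlepath_residue_theorem[OF finQ hol])
    have False if "z \<in> P" "cmod z = 3 / 4" for z
    proof -
      have "\<exists>k. z \<in> ball (c k) (\<rho> k)" using hole[of z] that by auto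
      then have "z \<in> ball 0 (1 / 2)" using inner mono(1) by blast
      then show False using that by simp
    qed
    then show "Q \<inter> sphere 0 (3 / 4) = {}" using y by (auto simp: Q_def)
  qed simp
  have c2: "contour_integral (circlepath (c k) (2 * \<rho> k)) h
      = 2 * pi * \<i> * (\<Sum>z\<in>Q \<inter> ball (c k) (2 * \<rho> k). residue h z)" for k
  proof (rule circlepath_residue_theorem[OF finQ hol])
    have "z \<notin> sphere (c k) (2 * \<rho> k)" if "z \<in> Q" for z
    proof
      assume "z \<in> sphere (c k) (2 * \<rho> k)"
      then have z: "z \<in> ball (c k) (3 * \<rho> k)" "z \<notin> ball (c k) (\<rho> k)" using \<rho>[of k] by auto
      then have "z \<notin> P" using hole_ball by blast
      moreover have "z \<noteq> 0" "z \<noteq> y" using z(1) inner[of k] by blast+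
      ultimately show False using that by (auto simp: Q_def)
    qed
    then show "Q \<inter> sphere (c k) (2 * \<rho> k) = {}" by blast
  qed (use \<rho>[of k] in simp)
  have op: "open (- (P \<union> A))" if "finite A" for A
    by (intro open_Compl finite_imp_closed) (simp add: P that)
  have res_y: "residue h y = f y"
  proof -
    have "residue (\<lambda>z. (f z * y / z) / (z - y)) y = f y * y / y"
    proof (rule residue_simple[OF op[of "{0}"]])
      show "(\<lambda>z. f z * y / z) holomorphic_on - (P \<union> {0})"
        by (intro holomorphic_intros holomorphic_on_subset[OF P(3)]) auto
    qed (use X0y P y in auto)
    then show ?thesis using y by (simp add: h_def)
  qed
  have res_0: "residue h 0 = - f 0"
  proof -
    have "residue (\<lambda>z. (f z * y / (z - y)) / (z - 0)) 0 = f 0 * y / (0 - y)"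
    proof (rule residue_simple[OF op[of "{y}"]])
      show "(\<lambda>z. f z * y / (z - y)) holomorphic_on - (P \<union> {y})"
        by (intro holomorphic_intros holomorphic_on_subset[OF P(3)]) auto
    qed (use X0y P y in auto)
    then show ?thesis using y by (simp add: h_def mult.commute)
  qed
  \<comment> \<open>Apart from 0 and \<open>y\<close>, each point of \<open>Q\<close> in the large
    disk lies in the hole selected by \<open>\<kappa>\<close>, so the residues can be grouped by
    hole.\<close>
  have split: "Q \<inter> ball 0 (3 / 4) = {0, y} \<union> (\<Union>k\<in>S. Q \<inter> ball (c k) (2 * \<rho> k))" (is "?L = ?R")
  proof
    have "z \<in> (\<Union>k\<in>S. Q \<inter> ball (c k) (2 * \<rho> k))" if "z \<in> P'" for z
    proof -
      have "z \<in> ball (c (\<kappa> z)) (2 * \<rho> (\<kappa> z))" using \<kappa>[OF that] \<rho>[of "\<kappa> z"] by auto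
      then show ?thesis using that by (auto simp: S_def P'_def Q_def)
    qed
    then show "?L \<subseteq> ?R" by (auto simp: Q_def P'_def)
    have "ball (c k) (2 * \<rho> k) \<subseteq> ball 0 (3 / 4)" for k
    proof -
      have "ball (c k) (2 * \<rho> k) \<subseteq> ball 0 (1 / 2)" using mono(2) inner by blast
      also have "\<dots> \<subseteq> ball 0 (3 / 4)" by (rule subset_ball) simp
      finally show ?thesis .
    qed
    moreover have "{0, y} \<subseteq> ?L" using y by (auto simp: Q_def)
    ultimately show "?R \<subseteq> ?L" by blast
  qed
  have "(\<Sum>z\<in>Q \<inter> ball 0 (3 / 4). residue h z)
      = (\<Sum>z\<in>{0, y}. residue h z) + (\<Sum>z\<in>(\<Union>k\<in>S. Q \<inter> ball (c k) (2 * \<rho> k)). residue h z)"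
    unfolding split
  proof (rule sum.union_disjoint)
    show "{0, y} \<inter> (\<Union>k\<in>S. Q \<inter> ball (c k) (2 * \<rho> k)) = {}"
      using mono(2) inner by blast
  qed (use finS finQ in auto)
  also have "(\<Sum>z\<in>{0, y}. residue h z) = f y - f 0" using y res_0 res_y by simp
  also have "(\<Sum>z\<in>(\<Union>k\<in>S. Q \<inter> ball (c k) (2 * \<rho> k)). residue h z)
      = (\<Sum>k\<in>S. \<Sum>z\<in>Q \<inter> ball (c k) (2 * \<rho> k). residue h z)"
  proof (rule sum.UNION_disjoint)
    show "\<forall>k\<in>S. \<forall>l\<in>S. k \<noteq> l \<longrightarrow> (Q \<inter> ball (c k) (2 * \<rho> k)) \<inter> (Q \<inter> ball (c l) (2 * \<rho> l)) = {}"
      using disj mono(2) by blast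
  qed (use finS finQ in auto)
  finally have "f y - f 0 = (\<Sum>z\<in>Q \<inter> ball 0 (3 / 4). residue h z)
      - (\<Sum>k\<in>S. \<Sum>z\<in>Q \<inter> ball (c k) (2 * \<rho> k). residue h z)"
    by (simp add: algebra_simps)
  then have "2 * pi * \<i> * (f y - f 0) =
      contour_integral (circlepath 0 (3 / 4)) h - (\<Sum>k\<in>S. contour_integral (circlepath (c k) (2 * \<rho> k)) h)"
    unfolding c1 c2 by (simp only: sum_distrib_left[symmetric] right_diff_distrib)
  with finS show ?thesis by blast
qed

text \<open>Each point of the circle is the centre of a disk of radius \<open>r\<close> inside
  \<open>X\<close>, so \<open>R0_norm_le_Lp_norm\<close> bounds \<open>f\<close> there; the kernel
  is at most \<open>cmod y / (A * B)\<close> and the length is \<open>2 * pi * s\<close>.\<close>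

lemma circle_integral_R0_bound:
  assumes X: "compact X" and p: "1 < p" and f: "f \<in> R0 X"
    and sub: "\<And>z. cmod (z - c) = s \<Longrightarrow> ball z r \<subseteq> X" and r: "0 < r" and s: "0 < s"
    and lower: "\<And>z. cmod (z - c) = s \<Longrightarrow> A \<le> cmod z" "\<And>z. cmod (z - c) = s \<Longrightarrow> B \<le> cmod (z - y)"
    and AB: "0 < A" "0 < B"
  shows "cmod (contour_integral (circlepath c s) (\<lambda>z. f z * y / (z * (z - y))))
    \<le> 2 * pi * (s * (32 * (pi * r\<^sup>2) powr (- 1 / p)) * Lp_norm p X f * cmod y / (A * B))"
proof -
  let ?h = "\<lambda>z. f z * y / (z * (z - y))"
  let ?M = "32 * (pi * r\<^sup>2) powr (- 1 / p) * Lp_norm p X f"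
  have M0: "?M \<ge> 0" by (simp add: Lp_norm_nonneg)
  have sX: "sphere c s \<subseteq> X"
    using sub r by (force simp: dist_norm norm_minus_commute)
  have nz: "z \<noteq> 0" "z \<noteq> y" if "z \<in> sphere c s" for z
    using that lower[of z] AB by (auto simp: dist_norm norm_minus_commute)
  have "continuous_on (sphere c s) ?h"
    using nz by (intro continuous_intros continuous_on_subset[OF R0_continuous_on[OF f] sX]) auto
  then have "?h contour_integrable_on circlepath c s"
    using s by (intro contour_integrable_continuous_circlepath) auto
  then have "(?h has_contour_integral contour_integral (circlepath c s) ?h) (circlepath c s)"
    by (rule has_contour_integral_integral)
  then have "norm (contour_integral (circlepath c s) ?h) \<le> (?M * cmod y / (A * B)) * (2 * pi * s)"
  proof (rule has_contour_integral_bound_circlepath)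
    show "0 \<le> ?M * cmod y / (A * B)" using AB by (simp add: Lp_norm_nonneg)
    fix z assume z: "cmod (z - c) = s"
    have "cmod (?h z) = cmod (f z) * cmod y / (cmod z * cmod (z - y))"
      by (simp add: norm_mult norm_divide)
    also have "\<dots> \<le> ?M * cmod y / (A * B)"
      using AB lower[OF z] M0 R0_norm_le_Lp_norm[OF X sub[OF z] r f p]
      by (intro frac_le mult_right_mono mult_mono mult_pos_pos) auto
    finally show "cmod (?h z) \<le> ?M * cmod y / (A * B)" .
  qed (rule s)
  then show ?thesis by (simp add: mult_ac)
qed

section \<open>Sums with geometric decay or growth\<close>

text \<open>From the least index of \<open>S\<close> on, the terms are dominated by a geometric
  series with first term \<open>A\<close>.\<close>

lemma sum_halving_le:
  fixes a :: "nat \<Rightarrow> real"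
  assumes half: "\<And>k. a (Suc k) \<le> a k / 2"
    and S: "finite S" "\<And>k. k \<in> S \<Longrightarrow> a k \<le> A" and A: "0 \<le> A"
  shows "(\<Sum>k\<in>S. a k) \<le> 2 * A"
proof (cases "S = {}")
  case False
  define m where "m = Min S"
  have m: "m \<in> S" "\<And>k. k \<in> S \<Longrightarrow> m \<le> k" using S False by (auto simp: m_def)
  have geo: "a (m + j) \<le> A * (1 / 2) ^ j" for j
  proof (induction j)
    case (Suc j)
    then show ?case using half[of "m + j"] by simp
  qed (use S m in simp)
  have "(\<Sum>k\<in>S. a k) = (\<Sum>j\<in>(\<lambda>k. k - m) ` S. a (m + j))"
  proof (subst sum.reindex)
    show "inj_on (\<lambda>k. k - m) S" by (rule inj_onI) (metis m(2) le_add_diff_inverse)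
  qed (use m in \<open>auto intro!: sum.cong\<close>)
  also have "\<dots> \<le> (\<Sum>j\<in>(\<lambda>k. k - m) ` S. A * (1 / 2) ^ j)" by (intro sum_mono geo)
  also have "\<dots> \<le> (\<Sum>j. A * (1 / 2) ^ j)"
    using S A by (intro sum_le_suminf summable_mult summable_geometric) auto
  also have "\<dots> = 2 * A" by (simp add: suminf_mult suminf_geometric)
  finally show ?thesis .
qed (use A in simp)

text \<open>Under doubling, a full partial sum is at most twice its last term; here the last term is
  the one at the largest index of \<open>S\<close>.\<close>

lemma sum_doubling_le:
  fixes a :: "nat \<Rightarrow> real"
  assumes pos: "\<And>k. 0 < a k" and doub: "\<And>k. 2 * a k \<le> a (Suc k)"
    and S: "finite S" "\<And>k. k \<in> S \<Longrightarrow> a k \<le> A" and A: "0 \<le> A"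
  shows "(\<Sum>k\<in>S. a k) \<le> 2 * A"
proof (cases "S = {}")
  case False
  define m where "m = Max S"
  have m: "m \<in> S" "\<And>k. k \<in> S \<Longrightarrow> k \<le> m" using S False by (auto simp: m_def)
  have sum: "(\<Sum>k\<le>n. a k) \<le> 2 * a n" for n
  proof (induction n)
    case 0
    show ?case using pos[of 0] by simp
  next
    case (Suc n)
    then show ?case using doub[of n] by simp
  qed
  have "(\<Sum>k\<in>S. a k) \<le> (\<Sum>k\<le>m. a k)"
    using m pos by (intro sum_mono2) (auto intro: less_imp_le)
  also have "\<dots> \<le> 2 * A" using sum[of m] S(2)[OF m(1)] by simp
  finally show ?thesis .
qed (use A in simp)

text \<open>
  The complement is a countable union, over rational \<open>s\<close>, of the relatively open sets \<open>V s\<close> cut with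
  \<open>{y. g y < s}\<close>, so the uncountable quantifier over \<open>f\<close> is harmless.
\<close>

lemma R0_estimate_set_measurable:
  assumes X: "compact X" and g: "g \<in> borel_measurable borel"
  shows "{y \<in> X. \<forall>f\<in>R0 X. cmod (f y - f 0) \<le> g y * Lp_norm p X f} \<in> sets borel"
proof -
  define V where "V s = (\<Union>f\<in>R0 X. {y \<in> X. s * Lp_norm p X f < cmod (f y - f 0)})" for s
  have V: "V s \<in> sets borel" for s
  proof -
    have "openin (top_of_set X) {y \<in> X. s * Lp_norm p X f < cmod (f y - f 0)}" if "f \<in> R0 X" for f
    proof -
      have "continuous_on X (\<lambda>y. cmod (f y - f 0))"
        by (intro continuous_intros R0_continuous_on that)
      from continuous_openin_preimage_gen[OF this, of "{s * Lp_norm p X f<..}"]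
      have "openin (top_of_set X) (X \<inter> (\<lambda>y. cmod (f y - f 0)) -` {s * Lp_norm p X f<..})" by simp
      also have "X \<inter> (\<lambda>y. cmod (f y - f 0)) -` {s * Lp_norm p X f<..} = {y \<in> X. s * Lp_norm p X f < cmod (f y - f 0)}"
        by auto
      finally show ?thesis .
    qed
    then have "openin (top_of_set X) (V s)" unfolding V_def by blast
    then obtain T where "open T" "V s = X \<inter> T" unfolding openin_open by auto
    moreover have "X \<in> sets borel" using X by (intro borel_closed compact_imp_closed)
    ultimately show ?thesis by auto
  qed
  have eq: "{y \<in> X. \<forall>f\<in>R0 X. cmod (f y - f 0) \<le> g y * Lp_norm p X f}
      = X - (\<Union>s\<in>\<rat>. V s \<inter> {y. g y < s})" (is "?L = ?R")
  proof
    show "?R \<subseteq> ?L"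
    proof
      fix y assume y: "y \<in> ?R"
      have "cmod (f y - f 0) \<le> g y * Lp_norm p X f" if f: "f \<in> R0 X" for f
      proof (rule ccontr)
        assume n: "\<not> cmod (f y - f 0) \<le> g y * Lp_norm p X f"
        have "\<exists>s\<in>\<rat>. g y < s \<and> s * Lp_norm p X f < cmod (f y - f 0)"
        \<comment> \<open>If the norm vanishes it cannot be divided by, but then any rational
          \<open>s\<close> above \<open>g y\<close> serves.\<close>
        proof (cases "Lp_norm p X f = 0")
          case True
          obtain s where "s \<in> \<rat>" "g y < s" using Rats_dense_in_real[of "g y" "g y + 1"] by auto
          then show ?thesis using n True by auto
        next
          case False
          then have N: "Lp_norm p X f > 0" using Lp_norm_nonneg[of p X f] by simp
          then have "g y < cmod (f y - f 0) / Lp_norm p X f" using n by (simp add: field_simps)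
          then obtain s where "s \<in> \<rat>" "g y < s" "s < cmod (f y - f 0) / Lp_norm p X f"
            using Rats_dense_in_real by blast
          then show ?thesis using N by (auto simp: field_simps)
        qed
        then show False using y f by (auto simp: V_def)
      qed
      then show "y \<in> ?L" using y by blast
    qed
    show "?L \<subseteq> ?R"
    proof
      fix y assume y: "y \<in> ?L"
      have False if "y \<in> V s" "g y < s" for s
      proof -
        from \<open>y \<in> V s\<close> obtain f where f: "f \<in> R0 X" "s * Lp_norm p X f < cmod (f y - f 0)"
          by (auto simp: V_def)
        have "g y * Lp_norm p X f \<le> s * Lp_norm p X f"
          using that by (intro mult_right_mono Lp_norm_nonneg) auto
        then show False using f y by fastforce
      qed
      then show "y \<in> ?R" using y by auto
    qed
  qed
  have "{y. g y < s} \<in> sets borel" for s using g by measurable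
  then have "(\<Union>s\<in>\<rat>. V s \<inter> {y. g y < s}) \<in> sets borel"
    using V by (intro sets.countable_UN' countable_rat) auto
  then show ?thesis
    unfolding eq using X by (intro sets.Diff) (auto intro: borel_closed compact_imp_closed)
qed

text \<open>\<open>\<phi>\<close> is unconstrained off the positive half-line, so monotonicity gives
  measurability on that subspace first, and extension by 0 carries it over.\<close>

lemma mono_on_pos_ext0_measurable:
  assumes "mono_on {0<..} \<phi>"
  shows "(\<lambda>y :: complex. ext0 \<phi> (cmod y)) \<in> borel_measurable borel"
proof -
  have "\<phi> \<in> borel_measurable (restrict_space borel {0<..})"
    by (rule borel_measurable_mono_on_fnc[OF assms])
  then have "(\<lambda>r. if r \<in> {0<..} then \<phi> r else 0) \<in> borel_measurable borel"
    by (subst (asm) measurable_restrict_space_iff[where c = 0]) auto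
  then have "(\<lambda>y :: complex. if cmod y \<in> {0<..} then \<phi> (cmod y) else 0) \<in> borel_measurable borel"
    by measurable
  also have "(\<lambda>y :: complex. if cmod y \<in> {0<..} then \<phi> (cmod y) else 0) = (\<lambda>y. ext0 \<phi> (cmod y))"
    by (auto simp: ext0_def fun_eq_iff)
  finally show ?thesis .
qed

section \<open>The set with sparse holes\<close>

text \<open>Its power \<open>2 * q\<close> is \<open>1 / (k + 1)\<close>, the harmonic term sought.
  Since \<open>hole_radius\<close> contains the square, one factor can pay for the distance of
  \<open>y\<close> from the hole while the other still tends to 0.\<close>

definition weight :: "real \<Rightarrow> nat \<Rightarrow> real" where
  "weight q k = real (Suc k) powr (- 1 / (2 * q))"

text \<open>The exponent is the one for which the radius to the power \<open>2 - q\<close> is \<open>(\<phi> d * d) powr q / (k + 1)\<close>.\<close>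

definition hole_radius :: "(real \<Rightarrow> real) \<Rightarrow> real \<Rightarrow> nat \<Rightarrow> real \<Rightarrow> real" where
  "hole_radius \<phi> q k d = ((weight q k)\<^sup>2 * \<phi> d * d) powr (q / (2 - q))"

text \<open>\<open>N k\<close> is the index of the annulus carrying the \<open>k\<close>-th hole.
  The halving conditions make sums over the holes geometric, the radius condition makes each hole
  tiny compared with the disk that \<open>y\<close> has to avoid, and \<open>1 \<le> N 0\<close>
  keeps the holes in \<open>ball 0 (1 / 2)\<close>.\<close>

locale sparse_holes =
  fixes \<phi> :: "real \<Rightarrow> real" and p q :: real and N :: "nat \<Rightarrow> nat"
  assumes adm: "admissible \<phi>" and p: "2 < p" and q: "q = p / (p - 1)"
    and N: "strict_mono N" "1 \<le> N 0"
    and phi_half': "\<And>k. \<phi> (2 powr - real (N (Suc k))) \<le> \<phi> (2 powr - real (N k)) / 2"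
    and psi_half': "\<And>k. assoc_fun \<phi> (2 powr - real (N (Suc k))) \<le> assoc_fun \<phi> (2 powr - real (N k)) / 2"
    and radius_le': "\<And>k. 64 * hole_radius \<phi> q k (2 powr - real (N k)) \<le> weight q k * 2 powr - real (N k)"
begin

abbreviation "\<psi> \<equiv> assoc_fun \<phi>"
definition "\<beta> = weight q"
definition "d k = 2 powr - real (N k)"
definition "\<rho> k = hole_radius \<phi> q k (d k)"
text \<open>Midway between the radii \<open>d k / 2\<close> and \<open>d k\<close> of the
  annulus.\<close>

definition "c k = complex_of_real (3 / 4 * d k)"
definition "X = cball 0 1 - (\<Union>k. ball (c k) (\<rho> k))"

lemmas phi_half = phi_half'[folded d_def]
lemmas psi_half = psi_half'[folded d_def]
lemmas radius_le = radius_le'[folded d_def, folded \<rho>_def \<beta>_def]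

lemma phi_pos: "0 < t \<Longrightarrow> 0 < \<phi> t"
  and psi_pos: "0 < t \<Longrightarrow> 0 < \<psi> t"
  and phi_mono: "0 < s \<Longrightarrow> s \<le> t \<Longrightarrow> \<phi> s \<le> \<phi> t"
  and psi_mono: "0 < s \<Longrightarrow> s \<le> t \<Longrightarrow> \<psi> s \<le> \<psi> t"
  and psi_tendsto: "(\<psi> \<longlongrightarrow> 0) (at_right 0)"
  using adm by (auto simp: admissible_def mono_on_def)

text \<open>The last identity converts \<open>1 - 2 / p\<close>, the exponent of the radius in the
  circle estimate, into the capacity exponent \<open>2 - q\<close>.\<close>

lemma pq: "1 < q" "q < 2" "1 / p + 1 / q = 1" "q * (1 - 2 / p) = 2 - q"
  using p by (auto simp: q field_simps)

lemma beta: "0 < \<beta> k" "\<beta> k \<le> 1"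
proof -
  show "0 < \<beta> k" by (simp add: \<beta>_def weight_def)
  have "real (Suc k) powr (- 1 / (2 * q)) \<le> real (Suc k) powr 0"
    using pq by (intro powr_mono) auto
  then show "\<beta> k \<le> 1" by (simp add: \<beta>_def weight_def)
qed

lemma beta_tendsto: "\<beta> \<longlonglongrightarrow> 0"
  unfolding \<beta>_def weight_def using pq
  by (intro tendsto_neg_powr filterlim_compose[OF filterlim_real_sequentially filterlim_Suc]) auto

lemma d_pos: "0 < d k"
  by (simp add: d_def)

lemma d_less:
  assumes "k < l" shows "d l \<le> d k / 2"
proof -
  have "N k < N l" using N(1) assms by (rule strict_monoD)
  then have "2 powr - real (N l) \<le> 2 powr (- real (N k) - 1)"
    by (intro powr_mono) auto
  then show ?thesis by (simp add: d_def powr_diff)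
qed

lemma d_antimono: "k \<le> l \<Longrightarrow> d l \<le> d k"
  using d_less[of k l] d_pos[of k] by (cases "k = l") auto

lemma d_le: "d k \<le> 1 / 2"
proof -
  have "d 0 \<le> 2 powr (- 1)" unfolding d_def using N(2) by (intro powr_mono) auto
  then show ?thesis using d_antimono[of 0 k] by (simp add: powr_minus)
qed

lemma d_tendsto: "d \<longlonglongrightarrow> 0"
proof (rule tendsto_sandwich[OF _ _ tendsto_const])
  have "d k \<le> (1 / 2) ^ k" for k
  proof (induction k)
    case 0
    show ?case using d_le[of 0] by simp
  next
    case (Suc k)
    then show ?case using d_less[of k "Suc k"] by simp
  qed
  then show "\<forall>\<^sub>F k in sequentially. d k \<le> (1 / 2) ^ k" by simp
  show "(\<lambda>k. (1 / 2 :: real) ^ k) \<longlonglongrightarrow> 0" by (intro LIMSEQ_power_zero) auto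
  show "\<forall>\<^sub>F k in sequentially. 0 \<le> d k" using d_pos by (auto intro: always_eventually less_imp_le)
qed

lemma rho_pos: "0 < \<rho> k"
  using phi_pos[OF d_pos] d_pos[of k] beta(1)[of k]
  by (auto simp: \<rho>_def hole_radius_def \<beta>_def less_le)

text \<open>The exponent in \<open>hole_radius\<close> is the reciprocal of
  \<open>1 - 2 / p\<close>. Up to a constant, the left side is the length of the circle times the
  bound for point evaluations on it.\<close>

lemma rho_powr: "\<rho> k powr (1 - 2 / p) = (\<beta> k)\<^sup>2 * \<phi> (d k) * d k"
proof -
  have "0 < (\<beta> k)\<^sup>2 * \<phi> (d k) * d k" using phi_pos[OF d_pos] d_pos[of k] beta(1)[of k] by simp
  moreover have e: "q / (2 - q) * (1 - 2 / p) = 1"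
    using pq by (metis diff_gt_0_iff_gt divide_self less_irrefl times_divide_eq_left)
  ultimately show ?thesis
    by (simp only: \<rho>_def hole_radius_def \<beta>_def[symmetric] powr_powr e) simp
qed

lemma rho_le: "64 * \<rho> k \<le> d k"
  using radius_le[of k] mult_left_le_one_le[of "d k" "\<beta> k"] beta[of k] d_pos[of k] by linarith

text \<open>By \<open>rho_le\<close> the tripled radius is at most \<open>3 / 64 * d k\<close>,
  below the margin \<open>d k / 4\<close> between \<open>c k\<close> and the edges of the
  annulus.\<close>

lemma ball_hole:
  assumes "z \<in> ball (c k) (3 * \<rho> k)"
  shows "d k / 2 < cmod z" "cmod z < d k"
proof -
  have c: "cmod (c k) = 3 / 4 * d k" using d_pos[of k] by (simp add: c_def norm_mult)
  have "cmod (z - c k) < 3 / 64 * d k"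
    using assms rho_le[of k] by (simp add: dist_norm norm_minus_commute)
  then show "d k / 2 < cmod z" "cmod z < d k"
    using norm_triangle_ineq2[of "c k" z] norm_triangle_ineq2[of z "c k"] c d_pos[of k]
    by (simp_all add: norm_minus_commute)
qed

lemma balls_disjoint:
  assumes "k \<noteq> l" shows "ball (c k) (3 * \<rho> k) \<inter> ball (c l) (3 * \<rho> l) = {}"
proof -
  have "ball (c k) (3 * \<rho> k) \<inter> ball (c l) (3 * \<rho> l) = {}" if "k < l" for k l
  proof -
    have False if "z \<in> ball (c k) (3 * \<rho> k)" "z \<in> ball (c l) (3 * \<rho> l)" for z
      using ball_hole(1)[OF that(1)] ball_hole(2)[OF that(2)] d_less[OF \<open>k < l\<close>] by linarith
    then show ?thesis by blast
  qed
  then show ?thesis using assms by (metis Int_commute linorder_neqE_nat)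
qed

lemma compact_X: "compact X"
proof -
  have "X = cball 0 1 \<inter> - (\<Union>k. ball (c k) (\<rho> k))" by (auto simp: X_def)
  moreover have "closed (- (\<Union>k. ball (c k) (\<rho> k)))" by (intro closed_Compl open_UN) auto
  ultimately show ?thesis by (simp add: compact_Int_closed)
qed

lemma zero_in_X: "0 \<in> X"
proof -
  have "0 \<notin> ball (c k) (\<rho> k)" for k
    using ball_hole(1)[of 0 k] d_pos[of k] rho_pos[of k] by force
  then show ?thesis by (simp add: X_def)
qed

text \<open>The disk stays between the radii \<open>\<rho> k\<close> and \<open>3 * \<rho> k\<close>
  about \<open>c k\<close>: outside its own hole, and outside the others because tripled disks are
  disjoint.\<close>

lemma ball_subset_X:
  assumes z: "cmod (z - c k) = 2 * \<rho> k"
  shows "ball z (\<rho> k) \<subseteq> X"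
proof
  fix w assume w: "w \<in> ball z (\<rho> k)"
  have tri: "cmod (w - c k) \<le> cmod (w - z) + cmod (z - c k)" "cmod (z - c k) \<le> cmod (w - z) + cmod (w - c k)"
    using norm_triangle_ineq[of "w - z" "z - c k"] norm_triangle_ineq4[of "w - c k" "w - z"]
    by (simp_all add: algebra_simps)
  then have wk: "w \<in> ball (c k) (3 * \<rho> k)" "w \<notin> ball (c k) (\<rho> k)"
    using w z by (auto simp: dist_norm norm_minus_commute)
  have "w \<notin> ball (c l) (\<rho> l)" for l
  proof (cases "l = k")
    case False
    then have "w \<notin> ball (c l) (3 * \<rho> l)" using wk(1) balls_disjoint[of l k] by blast
    then show ?thesis using rho_pos[of l] by auto
  qed (use wk in simp)
  then show "w \<in> X" using ball_hole(2)[OF wk(1)] d_le[of k] by (simp add: X_def)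
qed

section \<open>Distance from the holes\<close>

text \<open>By \<open>radius_le\<close> these radii are at least \<open>16 * \<rho> k\<close>, so
  points outside keep their distance from the holes; they are also \<open>o(d k)\<close>, so the
  disks have area density zero at the origin.\<close>

definition excluded :: "complex set" where
  "excluded = (\<Union>k. ball (c k) (\<beta> k / 4 * d k))"

text \<open>The distance from \<open>y\<close> to \<open>c k\<close> is at least twice the claimed
  bound: near the annulus by the choice of \<open>excluded\<close>, far outside by the triangle
  inequality. The circle radius \<open>2 * \<rho> k\<close> uses up at most half of it.\<close>

lemma not_excluded_dist:
  assumes y: "y \<notin> excluded" and z: "cmod (z - c k) = 2 * \<rho> k"
  shows "\<beta> k / 16 * max (cmod y) (d k) \<le> cmod (z - y)"
proof -
  have c: "cmod (c k) = 3 / 4 * d k" using d_pos[of k] by (simp add: c_def norm_mult)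
  have yc: "\<beta> k / 4 * d k \<le> cmod (y - c k)"
  proof -
    have "y \<notin> ball (c k) (\<beta> k / 4 * d k)" using y unfolding excluded_def by blast
    then show ?thesis by (simp add: dist_norm norm_minus_commute)
  qed
  have "\<beta> k / 8 * max (cmod y) (d k) \<le> cmod (y - c k)"
  proof (cases "cmod y \<le> 2 * d k")
    case True
    then have "\<beta> k / 8 * max (cmod y) (d k) \<le> \<beta> k / 8 * (2 * d k)"
      using beta(1)[of k] d_pos[of k] by (intro mult_left_mono) auto
    then show ?thesis using yc by simp
  next
    case False
    then have "cmod y / 2 \<le> cmod (y - c k)"
      using norm_triangle_ineq2[of y "c k"] c d_pos[of k] by linarith
    moreover have "\<beta> k / 8 * max (cmod y) (d k) \<le> 1 / 8 * cmod y"
      using False beta[of k] d_pos[of k] by (intro mult_mono) auto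
    ultimately show ?thesis using norm_ge_zero[of y] by linarith
  qed
  moreover have "2 * \<rho> k \<le> cmod (y - c k) / 2"
    using yc radius_le[of k] rho_pos[of k] by simp
  moreover have "cmod (y - c k) \<le> cmod (z - y) + cmod (z - c k)"
    using norm_triangle_ineq4[of "z - c k" "z - y"] by simp
  ultimately show ?thesis using z by simp
qed

section \<open>Summation over the holes\<close>

text \<open>For positive \<open>t\<close> both branches equal \<open>\<phi> (d k) / \<phi> t\<close>
  times the minimum of 1 and \<open>t / d k\<close>; the split shows which function makes the sum
  geometric.\<close>

definition decay :: "nat \<Rightarrow> real \<Rightarrow> real" where
  "decay k t = (if t \<le> d k then \<psi> t / \<psi> (d k) else \<phi> (d k) / \<phi> t)"

lemma decay_nonneg: "0 < t \<Longrightarrow> 0 \<le> decay k t"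
  using psi_pos[of t] psi_pos[of "d k"] phi_pos[of t] phi_pos[of "d k"] d_pos[of k]
  by (auto simp: decay_def)

lemma phi_times_decay:
  assumes "0 < t"
  shows "\<phi> (d k) * t / max t (d k) = \<phi> t * decay k t"
  using assms phi_pos[of t] phi_pos[of "d k"] d_pos[of k]
  by (auto simp: decay_def assoc_fun_def max_def field_simps)

text \<open>For \<open>t \<le> d k\<close> the numbers \<open>1 / \<psi> (d k)\<close> double with
  \<open>k\<close>; for the remaining \<open>k\<close> the numbers \<open>\<phi> (d k)\<close>
  halve. In either group each term is at most 1, so each group contributes at most 2.\<close>

lemma sum_decay_le:
  assumes t: "0 < t" and S: "finite S"
  shows "(\<Sum>k\<in>S. decay k t) \<le> 4"
proof -
  let ?A = "{k. t \<le> d k}"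
  have "(\<Sum>k\<in>S \<inter> ?A. decay k t) = \<psi> t * (\<Sum>k\<in>S \<inter> ?A. 1 / \<psi> (d k))"
    unfolding sum_distrib_left by (intro sum.cong) (auto simp: decay_def)
  also have "\<dots> \<le> \<psi> t * (2 * (1 / \<psi> t))"
  proof (intro mult_left_mono sum_doubling_le)
    show "2 * (1 / \<psi> (d k)) \<le> 1 / \<psi> (d (Suc k))" for k
      using psi_half[of k] psi_pos[OF d_pos, of k] psi_pos[OF d_pos, of "Suc k"]
      by (simp add: field_simps)
    show "1 / \<psi> (d k) \<le> 1 / \<psi> t" if "k \<in> S \<inter> ?A" for k
      using that t psi_mono[of t "d k"] psi_pos[of t] by (intro divide_left_mono mult_pos_pos psi_pos d_pos) auto
  qed (use t S psi_pos d_pos in \<open>auto intro: less_imp_le\<close>)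
  also have "\<dots> = 2" using psi_pos[OF t] by simp
  finally have 1: "(\<Sum>k\<in>S \<inter> ?A. decay k t) \<le> 2" .
  have "(\<Sum>k\<in>S - ?A. decay k t) = (\<Sum>k\<in>S - ?A. \<phi> (d k)) / \<phi> t"
    unfolding sum_divide_distrib by (intro sum.cong) (auto simp: decay_def)
  also have "\<dots> \<le> 2 * \<phi> t / \<phi> t"
    using t S by (intro divide_right_mono sum_halving_le phi_half phi_mono)
      (auto intro: less_imp_le phi_pos d_pos)
  also have "\<dots> = 2" using phi_pos[OF t] by simp
  finally have "(\<Sum>k\<in>S - ?A. decay k t) \<le> 2" .
  with 1 show ?thesis using sum.Int_Diff[OF S, of "\<lambda>k. decay k t" ?A] by simp
qed

text \<open>The first \<open>k0\<close> terms are at most \<open>\<psi> t\<close> times a constant,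
  which tends to 0; the others carry weights below \<open>\<eta> / 8\<close> and
  \<open>sum_decay_le\<close> supplies the factor 4.\<close>

lemma weighted_decay_small:
  assumes "0 < \<eta>"
  shows "\<forall>\<^sub>F t in at_right 0. \<forall>S. finite S \<longrightarrow> (\<Sum>k\<in>S. \<beta> k * decay k t) \<le> \<eta>"
proof -
  have "\<forall>\<^sub>F k in sequentially. \<beta> k < \<eta> / 8"
    using order_tendstoD(2)[OF beta_tendsto, of "\<eta> / 8"] assms by simp
  then obtain k0 where k0: "\<And>k. k \<ge> k0 \<Longrightarrow> \<beta> k < \<eta> / 8"
    by (auto simp: eventually_sequentially)
  define M where "M = (\<Sum>k<k0. \<beta> k / \<psi> (d k))"
  have "((\<lambda>t. \<psi> t * M) \<longlongrightarrow> 0 * M) (at_right 0)" by (intro tendsto_intros psi_tendsto)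
  then have "\<forall>\<^sub>F t in at_right 0. \<psi> t * M < \<eta> / 2"
    using order_tendstoD(2)[of _ "0 * M" _ "\<eta> / 2"] assms by simp
  moreover have "\<forall>\<^sub>F t in at_right 0. 0 < t \<and> t < d k0"
    using d_pos[of k0] unfolding eventually_at_right[OF d_pos[of k0]] by blast
  ultimately show ?thesis
  proof eventually_elim
    case (elim t)
    show ?case
    proof (intro allI impI)
      fix S :: "nat set" assume S: "finite S"
      have nn: "0 \<le> \<beta> k * decay k t" for k
        using beta(1)[of k] decay_nonneg[of t k] elim by simp
      have "(\<Sum>k\<in>S \<inter> {..<k0}. \<beta> k * decay k t) \<le> (\<Sum>k<k0. \<beta> k * decay k t)"
        using nn by (intro sum_mono2) auto
      also have "\<dots> = \<psi> t * M"
        unfolding M_def sum_distrib_left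
      proof (intro sum.cong refl)
        fix k assume "k \<in> {..<k0}"
        then have "t \<le> d k" using elim d_antimono[of k k0] by simp
        then show "\<beta> k * decay k t = \<psi> t * (\<beta> k / \<psi> (d k))" by (simp add: decay_def)
      qed
      finally have 1: "(\<Sum>k\<in>S \<inter> {..<k0}. \<beta> k * decay k t) \<le> \<eta> / 2" using elim by simp
      have "(\<Sum>k\<in>S - {..<k0}. \<beta> k * decay k t) \<le> (\<Sum>k\<in>S - {..<k0}. \<eta> / 8 * decay k t)"
        using k0 decay_nonneg elim by (intro sum_mono mult_right_mono) (auto intro: less_imp_le)
      also have "\<dots> = \<eta> / 8 * (\<Sum>k\<in>S - {..<k0}. decay k t)" by (simp add: sum_distrib_left)
      also have "\<dots> \<le> \<eta> / 8 * 4"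
        using elim S assms by (intro mult_left_mono sum_decay_le) auto
      finally have 2: "(\<Sum>k\<in>S - {..<k0}. \<beta> k * decay k t) \<le> \<eta> / 2" by simp
      show "(\<Sum>k\<in>S. \<beta> k * decay k t) \<le> \<eta>"
        using sum.Int_Diff[OF S, of "\<lambda>k. \<beta> k * decay k t" "{..<k0}"] 1 2 by simp
    qed
  qed
qed

section \<open>The estimate for \<open>f y - f 0\<close>\<close>

text \<open>The point evaluation constant for disks of radius \<open>1 / 4\<close>, times the radius
  \<open>3 / 4\<close> of the large circle over the lower bound \<open>3 / 4 * (1 / 4)\<close> for
  \<open>cmod z * cmod (z - y)\<close>.\<close>

definition outer_const :: real where
  "outer_const = 4 * (32 * (pi * (1 / 4)\<^sup>2) powr (- 1 / p))"

text \<open>Of the two factors \<open>\<beta> k\<close> in \<open>rho_powr\<close>, one cancels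
  against the distance bound of \<open>not_excluded_dist\<close>; the other one remains.\<close>

lemma ring_integral_bound:
  assumes y: "y \<noteq> 0" "y \<notin> excluded" and f: "f \<in> R0 X"
  shows "cmod (contour_integral (circlepath (c k) (2 * \<rho> k)) (\<lambda>z. f z * y / (z * (z - y))))
    \<le> 2 * pi * (2048 * (\<beta> k * (\<phi> (cmod y) * decay k (cmod y))) * Lp_norm p X f)"
proof -
  let ?m = "max (cmod y) (d k)" and ?F = "Lp_norm p X f"
  have m: "0 < ?m" using d_pos[of k] by simp
  have zball: "z \<in> ball (c k) (3 * \<rho> k)" if "cmod (z - c k) = 2 * \<rho> k" for z
    using that rho_pos[of k] by (simp add: dist_norm norm_minus_commute)
  have "cmod (contour_integral (circlepath (c k) (2 * \<rho> k)) (\<lambda>z. f z * y / (z * (z - y))))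
    \<le> 2 * pi * (2 * \<rho> k * (32 * (pi * (\<rho> k)\<^sup>2) powr (- 1 / p)) * ?F * cmod y / (d k / 2 * (\<beta> k / 16 * ?m)))"
  proof (rule circle_integral_R0_bound[OF compact_X _ f ball_subset_X])
    show "d k / 2 \<le> cmod z" if "cmod (z - c k) = 2 * \<rho> k" for z
      using ball_hole(1)[OF zball[OF that]] by simp
    show "\<beta> k / 16 * ?m \<le> cmod (z - y)" if "cmod (z - c k) = 2 * \<rho> k" for z
      by (rule not_excluded_dist[OF y(2) that])
    show "0 < \<beta> k / 16 * ?m" using m beta(1)[of k] by simp
  qed (use p rho_pos[of k] d_pos[of k] in auto)
  \<comment> \<open>The constant is \<open>2 * 32 * 2 * 16\<close>, the last two factors coming from
    \<open>d k / 2\<close> and \<open>\<beta> k / 16\<close>.\<close>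
  also have "2 * \<rho> k * (32 * (pi * (\<rho> k)\<^sup>2) powr (- 1 / p)) * ?F * cmod y / (d k / 2 * (\<beta> k / 16 * ?m))
      = 2048 * (\<rho> k * (pi * (\<rho> k)\<^sup>2) powr (- 1 / p)) * (?F * cmod y / (d k * \<beta> k * ?m))"
    by simp
  also have "\<dots> \<le> 2048 * ((\<beta> k)\<^sup>2 * \<phi> (d k) * d k) * (?F * cmod y / (d k * \<beta> k * ?m))"
  proof (intro mult_right_mono mult_left_mono)
    have "(pi * (\<rho> k)\<^sup>2) powr (- 1 / p) \<le> ((\<rho> k)\<^sup>2) powr (- 1 / p)"
      using rho_pos[of k] p pi_gt3 by (intro powr_mono2') auto
    also have "((\<rho> k)\<^sup>2) powr (- 1 / p) = (\<rho> k powr 2) powr (- 1 / p)"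
      using rho_pos[of k] by simp
    also have "\<dots> = \<rho> k powr (- 2 / p)" by (simp add: powr_powr)
    finally have "\<rho> k * (pi * (\<rho> k)\<^sup>2) powr (- 1 / p) \<le> \<rho> k powr 1 * \<rho> k powr (- 2 / p)"
      using rho_pos[of k] by simp
    also have "\<dots> = \<rho> k powr (1 - 2 / p)" by (simp only: powr_add[symmetric]) simp
    finally show "\<rho> k * (pi * (\<rho> k)\<^sup>2) powr (- 1 / p) \<le> (\<beta> k)\<^sup>2 * \<phi> (d k) * d k"
      by (simp only: rho_powr)
  qed (use m beta(1)[of k] d_pos[of k] Lp_norm_nonneg in auto)
  also have "\<dots> = 2048 * (\<beta> k * (\<phi> (d k) * cmod y / ?m)) * ?F"
    using m beta(1)[of k] d_pos[of k] by (simp add: field_simps power2_eq_square)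
  also have "\<phi> (d k) * cmod y / ?m = \<phi> (cmod y) * decay k (cmod y)"
    using y by (intro phi_times_decay) simp
  finally show ?thesis by simp
qed

text \<open>The residue identity is estimated circle by circle. \<open>S\<close> depends on the
  poles of \<open>f\<close>, so a later bound has to be uniform over finite sets.\<close>

lemma R0_difference_estimate:
  assumes y: "y \<noteq> 0" "cmod y < 1 / 2" "y \<notin> excluded" and f: "f \<in> R0 X"
  shows "\<exists>S. finite S \<and> cmod (f y - f 0) \<le>
    (outer_const * \<psi> (cmod y) + 2048 * (\<Sum>k\<in>S. \<beta> k * decay k (cmod y))) * \<phi> (cmod y) * Lp_norm p X f"
proof -
  let ?h = "\<lambda>z. f z * y / (z * (z - y))" and ?F = "Lp_norm p X f"
  have inner: "ball (c k) (3 * \<rho> k) \<subseteq> ball 0 (1 / 2) - {0, y}" for k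
  proof
    fix z assume z: "z \<in> ball (c k) (3 * \<rho> k)"
    have "3 * \<rho> k \<le> \<beta> k / 4 * d k" using radius_le[of k] rho_pos[of k] by simp
    then have "z \<in> ball (c k) (\<beta> k / 4 * d k)" using z by auto
    then have "z \<in> excluded" by (auto simp: excluded_def)
    then show "z \<in> ball 0 (1 / 2) - {0, y}"
      using ball_hole[OF z] d_pos[of k] d_le[of k] y by auto
  qed
  obtain S where S: "finite S" and eq: "2 * pi * \<i> * (f y - f 0) = contour_integral (circlepath 0 (3 / 4)) ?h
      - (\<Sum>k\<in>S. contour_integral (circlepath (c k) (2 * \<rho> k)) ?h)"
    using R0_difference_eq_contour_integrals[OF X_def rho_pos balls_disjoint inner y(1,2) f] by blast
  have "cmod (contour_integral (circlepath 0 (3 / 4)) ?h)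
      \<le> 2 * pi * (3 / 4 * (32 * (pi * (1 / 4)\<^sup>2) powr (- 1 / p)) * ?F * cmod y / (3 / 4 * (1 / 4)))"
  proof (rule circle_integral_R0_bound[OF compact_X _ f])
    fix z :: complex assume z: "cmod (z - 0) = 3 / 4"
    \<comment> \<open>Such a disk lies between the moduli \<open>1 / 2\<close> and 1, while the
      holes have modulus below \<open>d k \<le> 1 / 2\<close>.\<close>
    show "ball z (1 / 4) \<subseteq> X"
    proof
      fix w assume "w \<in> ball z (1 / 4)"
      then have w: "cmod w < 1" "1 / 2 < cmod w"
        using z norm_triangle_ineq2[of z w] norm_triangle_ineq2[of w z]
        by (auto simp: dist_norm norm_minus_commute)
      have "w \<notin> ball (c k) (\<rho> k)" for k
        using ball_hole(2)[of w k] d_le[of k] w rho_pos[of k] by force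
      then show "w \<in> X" using w by (simp add: X_def)
    qed
    show "1 / 4 \<le> cmod (z - y)" using z y norm_triangle_ineq2[of z y] by simp
  qed (use p in auto)
  also have "3 / 4 * (32 * (pi * (1 / 4)\<^sup>2) powr (- 1 / p)) * ?F * cmod y / (3 / 4 * (1 / 4))
      = outer_const * cmod y * ?F"
    by (simp add: outer_const_def)
  also have "cmod y = \<psi> (cmod y) * \<phi> (cmod y)"
    using phi_pos[of "cmod y"] y by (simp add: assoc_fun_def)
  finally have 1: "cmod (contour_integral (circlepath 0 (3 / 4)) ?h)
      \<le> 2 * pi * (outer_const * (\<psi> (cmod y) * \<phi> (cmod y)) * ?F)" .
  have "cmod (\<Sum>k\<in>S. contour_integral (circlepath (c k) (2 * \<rho> k)) ?h)
      \<le> (\<Sum>k\<in>S. 2 * pi * (2048 * (\<beta> k * (\<phi> (cmod y) * decay k (cmod y))) * ?F))"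
    by (intro sum_norm_le ring_integral_bound y f)
  also have "\<dots> = 2 * pi * (2048 * (\<Sum>k\<in>S. \<beta> k * decay k (cmod y)) * \<phi> (cmod y) * ?F)"
    by (simp add: sum_distrib_left sum_distrib_right mult_ac)
  finally have 2: "cmod (\<Sum>k\<in>S. contour_integral (circlepath (c k) (2 * \<rho> k)) ?h)
      \<le> 2 * pi * (2048 * (\<Sum>k\<in>S. \<beta> k * decay k (cmod y)) * \<phi> (cmod y) * ?F)" .
  have "2 * pi * cmod (f y - f 0) = cmod (2 * pi * \<i> * (f y - f 0))"
    by (simp add: norm_mult)
  also have "\<dots> \<le> cmod (contour_integral (circlepath 0 (3 / 4)) ?h)
      + cmod (\<Sum>k\<in>S. contour_integral (circlepath (c k) (2 * \<rho> k)) ?h)"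
    unfolding eq by (rule norm_triangle_ineq4)
  also have "\<dots> \<le> 2 * pi * ((outer_const * \<psi> (cmod y)
      + 2048 * (\<Sum>k\<in>S. \<beta> k * decay k (cmod y))) * \<phi> (cmod y) * ?F)"
    using add_mono[OF 1 2] by (simp only: distrib_left distrib_right mult.assoc)
  finally have "cmod (f y - f 0) \<le> (outer_const * \<psi> (cmod y)
      + 2048 * (\<Sum>k\<in>S. \<beta> k * decay k (cmod y))) * \<phi> (cmod y) * ?F"
    by (rule mult_left_le_imp_le) simp
  with S show ?thesis by blast
qed

definition estimate_set :: "real \<Rightarrow> complex set" where
  "estimate_set \<epsilon> = {y \<in> X. \<forall>f\<in>R0 X. cmod (f y - f 0) \<le> \<epsilon> * ext0 \<phi> (cmod y) * Lp_norm p X f}"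

lemma estimate_set_measurable: "estimate_set \<epsilon> \<in> sets borel"
proof -
  have [measurable]: "(\<lambda>y :: complex. ext0 \<phi> (cmod y)) \<in> borel_measurable borel"
    using adm by (intro mono_on_pos_ext0_measurable) (auto simp: admissible_def)
  show ?thesis
    unfolding estimate_set_def by (intro R0_estimate_set_measurable compact_X) measurable
qed

text \<open>The large circle and the rings each receive \<open>\<epsilon> / 2\<close>, for the rings
  as \<open>2048 * (\<epsilon> / 4096)\<close>. Uniformity in \<open>S\<close> makes the threshold
  \<open>t\<close> independent of \<open>f\<close>.\<close>

lemma estimate_near_zero:
  assumes \<epsilon>: "0 < \<epsilon>"
  shows "\<exists>t>0. \<forall>y. cmod y < t \<longrightarrow> y \<notin> excluded \<longrightarrow> y \<in> estimate_set \<epsilon>"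
proof -
  have "((\<lambda>t. outer_const * \<psi> t) \<longlongrightarrow> outer_const * 0) (at_right 0)"
    by (intro tendsto_intros psi_tendsto)
  then have "\<forall>\<^sub>F t in at_right 0. outer_const * \<psi> t < \<epsilon> / 2"
    using order_tendstoD(2)[of _ "outer_const * 0" _ "\<epsilon> / 2"] \<epsilon> by simp
  moreover have "\<forall>\<^sub>F t in at_right 0. \<forall>S. finite S \<longrightarrow> (\<Sum>k\<in>S. \<beta> k * decay k t) \<le> \<epsilon> / 4096"
    using \<epsilon> by (intro weighted_decay_small) simp
  ultimately have "\<forall>\<^sub>F t in at_right 0. outer_const * \<psi> t < \<epsilon> / 2 \<and>
      (\<forall>S. finite S \<longrightarrow> (\<Sum>k\<in>S. \<beta> k * decay k t) \<le> \<epsilon> / 4096)"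
    by eventually_elim blast
  then obtain t0 where t0: "0 < t0" and small: "\<And>t. 0 < t \<Longrightarrow> t < t0 \<Longrightarrow> outer_const * \<psi> t < \<epsilon> / 2"
    "\<And>t S. 0 < t \<Longrightarrow> t < t0 \<Longrightarrow> finite S \<Longrightarrow> (\<Sum>k\<in>S. \<beta> k * decay k t) \<le> \<epsilon> / 4096"
    unfolding eventually_at_right[OF zero_less_one] by blast
  have "y \<in> estimate_set \<epsilon>" if y: "cmod y < min t0 (1 / 2)" "y \<notin> excluded" for y
  proof (cases "y = 0")
    \<comment> \<open>At the origin both sides are 0, by the value of \<open>ext0\<close>
      there.\<close>
    case True
    then show ?thesis by (simp add: estimate_set_def zero_in_X ext0_def)
  next
    case False
    have "y \<notin> ball (c k) (\<rho> k)" for k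
    proof -
      have "\<rho> k \<le> \<beta> k / 4 * d k" using radius_le[of k] rho_pos[of k] by simp
      then have "ball (c k) (\<rho> k) \<subseteq> ball (c k) (\<beta> k / 4 * d k)" by (rule subset_ball)
      also have "\<dots> \<subseteq> excluded" unfolding excluded_def by blast
      finally show ?thesis using y by blast
    qed
    then have "y \<in> X" using y by (simp add: X_def)
    moreover have "cmod (f y - f 0) \<le> \<epsilon> * ext0 \<phi> (cmod y) * Lp_norm p X f" if f: "f \<in> R0 X" for f
    proof -
      obtain S where S: "finite S" and "cmod (f y - f 0) \<le>
          (outer_const * \<psi> (cmod y) + 2048 * (\<Sum>k\<in>S. \<beta> k * decay k (cmod y))) * \<phi> (cmod y) * Lp_norm p X f"
        using R0_difference_estimate[OF False _ y(2) f] y by auto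
      note this(2)
      also have "\<dots> \<le> \<epsilon> * \<phi> (cmod y) * Lp_norm p X f"
      proof (intro mult_right_mono Lp_norm_nonneg)
        show "outer_const * \<psi> (cmod y) + 2048 * (\<Sum>k\<in>S. \<beta> k * decay k (cmod y)) \<le> \<epsilon>"
          using small(1)[of "cmod y"] small(2)[of "cmod y" S] S False y by simp
      qed (use phi_pos[of "cmod y"] False in simp)
      finally show ?thesis using False by (simp add: ext0_def)
    qed
    ultimately show ?thesis by (simp add: estimate_set_def)
  qed
  moreover have "0 < min t0 (1 / 2)" using t0 by simp
  ultimately show ?thesis by blast
qed

section \<open>Area density at the origin\<close>

text \<open>Only disks with \<open>d k < 2 * r\<close> meet \<open>ball 0 r\<close>. Their areas
  decrease geometrically, so the total is at most a multiple of \<open>\<eta>\<close> times the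
  square of the largest such \<open>d k\<close>.\<close>

lemma measure_excluded_le:
  assumes r: "0 < r" "2 * r \<le> d K" and \<beta>: "\<And>k. K \<le> k \<Longrightarrow> (\<beta> k)\<^sup>2 \<le> \<eta>"
    and sub: "B \<subseteq> ball 0 r \<inter> excluded"
  shows "measure lebesgue B \<le> \<eta> / 2 * (pi * r\<^sup>2)"
proof -
  \<comment> \<open>The outermost annulus that can contribute; \<open>2 * r \<le> d K\<close> forces
    \<open>K \<le> m\<close>, so the bound on \<open>\<beta>\<close> applies from there on.\<close>
  define m where "m = (LEAST k. d k < 2 * r)"
  have "\<forall>\<^sub>F k in sequentially. d k < 2 * r" using order_tendstoD(2)[OF d_tendsto] r by simp
  then have "\<exists>k. d k < 2 * r" by (auto simp: eventually_sequentially)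
  then have m: "d m < 2 * r" "\<And>k. d k < 2 * r \<Longrightarrow> m \<le> k"
    unfolding m_def by (auto intro: LeastI Least_le)
  have "K \<le> m"
    using m(1) r(2) d_antimono[of m K] by (cases "K \<le> m") auto
  have \<eta>: "0 \<le> \<eta>" using \<beta>[of K] by (smt (verit) order_refl zero_le_power2)
  have geo: "d (m + j) \<le> d m * (1 / 2) ^ j" for j
  proof (induction j)
    case (Suc j)
    then show ?case using d_less[of "m + j" "Suc (m + j)"] by simp
  qed simp
  let ?B = "\<lambda>j. ball (c (m + j)) (\<beta> (m + j) / 4 * d (m + j))"
  have cover: "B \<subseteq> (\<Union>j. ?B j)"
  proof
    fix z assume "z \<in> B"
    then have "z \<in> ball 0 r" "z \<in> excluded" using sub by blast+
    then obtain k where z: "cmod z < r" "z \<in> ball (c k) (\<beta> k / 4 * d k)"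
      unfolding excluded_def by auto
    have "\<beta> k / 4 * d k \<le> 1 / 4 * d k"
      using beta[of k] d_pos[of k] by (intro mult_right_mono) auto
    then have "cmod (c k - z) < 1 / 4 * d k" using z(2) by (simp add: dist_norm)
    moreover have "cmod (c k) = 3 / 4 * d k" using d_pos[of k] by (simp add: c_def norm_mult)
    ultimately have "d k < 2 * r" using norm_triangle_ineq2[of "c k" z] z(1) by linarith
    then have "k = m + (k - m)" using m(2)[of k] by simp
    then show "z \<in> (\<Union>j. ?B j)" using z(2) by (metis UN_I UNIV_I)
  qed
  have ball_le: "emeasure lebesgue (?B j) \<le> ennreal (pi * (\<eta> / 16 * (d m)\<^sup>2) * (1 / 2) ^ j)" for j
  proof -
    have "(\<beta> (m + j) / 4 * d (m + j))\<^sup>2 = (\<beta> (m + j))\<^sup>2 / 16 * (d (m + j))\<^sup>2"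
      by (simp add: power_mult_distrib power_divide)
    also have "\<dots> \<le> \<eta> / 16 * (d m * (1 / 2) ^ j)\<^sup>2"
      using \<beta>[of "m + j"] \<open>K \<le> m\<close> geo[of j] d_pos[of "m + j"] \<eta>
      by (intro mult_mono power_mono) auto
    also have "\<dots> = \<eta> / 16 * (d m)\<^sup>2 * ((1 / 2) ^ j)\<^sup>2" by (simp add: power_mult_distrib)
    also have "\<dots> \<le> \<eta> / 16 * (d m)\<^sup>2 * (1 / 2) ^ j"
      using \<eta> by (intro mult_left_mono) (auto simp: power2_eq_square mult_left_le power_le_one)
    finally have "pi * (\<beta> (m + j) / 4 * d (m + j))\<^sup>2 \<le> pi * (\<eta> / 16 * (d m)\<^sup>2) * (1 / 2) ^ j"
      by simp
    then show ?thesis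
      using beta(1)[of "m + j"] d_pos[of "m + j"]
      by (simp add: emeasure_lborel_ball_complex ennreal_leI)
  qed
  have "emeasure lebesgue B \<le> emeasure lebesgue (\<Union>j. ?B j)"
    using cover by (intro emeasure_mono) auto
  also have "\<dots> \<le> (\<Sum>j. emeasure lebesgue (?B j))"
    by (intro emeasure_subadditive_countably) auto
  also have "\<dots> \<le> (\<Sum>j. ennreal (pi * (\<eta> / 16 * (d m)\<^sup>2) * (1 / 2) ^ j))"
    by (intro suminf_le ball_le summableI)
  also have "\<dots> = ennreal (\<Sum>j. pi * (\<eta> / 16 * (d m)\<^sup>2) * (1 / 2) ^ j)"
    using \<eta> by (intro suminf_ennreal2 summable_mult summable_geometric) auto
  also have "(\<Sum>j. pi * (\<eta> / 16 * (d m)\<^sup>2) * (1 / 2) ^ j) = pi * (\<eta> / 16 * (d m)\<^sup>2) * (\<Sum>j. (1 / 2) ^ j)"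
    by (intro suminf_mult summable_geometric) simp
  also have "(\<Sum>j. (1 / 2 :: real) ^ j) = 2" by (simp add: suminf_geometric)
  also have "pi * (\<eta> / 16 * (d m)\<^sup>2) * 2 = pi * (\<eta> / 8) * (d m)\<^sup>2" by simp
  also have "\<dots> \<le> pi * (\<eta> / 8) * (2 * r)\<^sup>2"
    using \<eta> m(1) d_pos[of m] by (intro mult_left_mono power_mono) auto
  also have "\<dots> = \<eta> / 2 * (pi * r\<^sup>2)" by (simp add: power_mult_distrib)
  finally show ?thesis
    unfolding measure_def using \<eta> r by (intro enn2real_leI) (auto intro: ennreal_leI)
qed

text \<open>Near 0 the complement of the estimate set lies in \<open>excluded\<close>, whose share
  of \<open>ball 0 r\<close> is at most \<open>\<eta> / 2\<close> for small
  \<open>r\<close>.\<close>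

lemma estimate_set_density:
  assumes \<epsilon>: "0 < \<epsilon>"
  shows "full_area_density (estimate_set \<epsilon>) 0"
  unfolding full_area_density_def
proof
  show "estimate_set \<epsilon> \<in> sets lebesgue"
    using estimate_set_measurable by auto
  obtain t where t: "0 < t" and near: "\<And>y. cmod y < t \<Longrightarrow> y \<notin> excluded \<Longrightarrow> y \<in> estimate_set \<epsilon>"
    using estimate_near_zero[OF \<epsilon>] by blast
  show "((\<lambda>r. measure lebesgue (ball 0 r - estimate_set \<epsilon>) / measure lebesgue (ball (0 :: complex) r)) \<longlongrightarrow> 0)
      (at_right 0)"
  proof (rule tendstoI)
    fix \<eta> :: real assume \<eta>: "0 < \<eta>"
    have "(\<lambda>k. (\<beta> k)\<^sup>2) \<longlonglongrightarrow> 0" using tendsto_power[OF beta_tendsto, of 2] by simp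
    then have "\<forall>\<^sub>F k in sequentially. (\<beta> k)\<^sup>2 < \<eta>" using \<eta> by (rule order_tendstoD)
    then obtain K where K: "\<And>k. K \<le> k \<Longrightarrow> (\<beta> k)\<^sup>2 \<le> \<eta>"
      by (auto simp: eventually_sequentially intro: less_imp_le)
    have "0 < min t (d K / 2)" using t d_pos[of K] by simp
    then have "\<forall>\<^sub>F r in at_right 0. 0 < r \<and> r < min t (d K / 2)"
      unfolding eventually_at_right[OF \<open>0 < min t (d K / 2)\<close>] by blast
    then show "\<forall>\<^sub>F r in at_right 0. dist (measure lebesgue (ball 0 r - estimate_set \<epsilon>) / measure lebesgue (ball (0 :: complex) r)) 0 < \<eta>"
    proof eventually_elim
      case (elim r)
      have area: "measure lebesgue (ball (0 :: complex) r) = pi * r\<^sup>2"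
        using elim by (simp add: content_ball unit_ball_vol_2)
      have "ball 0 r - estimate_set \<epsilon> \<subseteq> ball 0 r \<inter> excluded"
      proof
        fix y assume "y \<in> ball 0 r - estimate_set \<epsilon>"
        then show "y \<in> ball 0 r \<inter> excluded" using near[of y] elim by auto
      qed
      then have "measure lebesgue (ball 0 r - estimate_set \<epsilon>) \<le> \<eta> / 2 * (pi * r\<^sup>2)"
        using elim by (intro measure_excluded_le[where K = K] K) auto
      also have "\<dots> < \<eta> * (pi * r\<^sup>2)" using \<eta> elim by (intro mult_strict_right_mono) auto
      finally show ?case using elim by (simp add: area pos_divide_less_eq)
    qed
  qed
qed

section \<open>Divergence of the capacity series\<close>

text \<open>The hole has capacity at least a constant times \<open>\<rho> k powr (2 - q)\<close>,
  which is \<open>(\<phi> (d k) * d k) powr q / (k + 1)\<close>; the factor in front cancels all but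
  \<open>1 / (k + 1)\<close>.\<close>

lemma capacity_term_ge:
  "ennreal (pi * (1 - 2 / p) powr q * (1 / 2) powr (2 - q) * (1 / real (Suc k)))
    \<le> ennreal (\<phi> (2 powr - real (N k)) powr - q * 2 powr (real (N k) * q)) * capacity_open q (annulus (N k) 0 - X)"
proof -
  define C where "C = pi * (1 - 2 / p) powr q * (1 / 2) powr (2 - q)"
  \<comment> \<open>The hole is open and \<open>capacity_open\<close> tests compact subsets, hence
    the closed disk of half the radius.\<close>
  have sub: "cball (c k) (\<rho> k / 2) \<subseteq> annulus (N k) 0 - X"
  proof
    fix z assume z: "z \<in> cball (c k) (\<rho> k / 2)"
    then have "z \<in> ball (c k) (3 * \<rho> k)" "z \<in> ball (c k) (\<rho> k)" using rho_pos[of k] by auto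
    moreover have "2 powr (- (real (N k) + 1)) = d k / 2"
      unfolding minus_add_distrib powr_add by (simp add: d_def powr_minus field_simps)
    ultimately show "z \<in> annulus (N k) 0 - X"
      using ball_hole[of z k] by (auto simp: annulus_def X_def d_def)
  qed
  have "ennreal (pi * (1 - 2 / p) powr q * (\<rho> k / 2) powr (2 - q)) \<le> capacity_compact q (cball (c k) (\<rho> k / 2))"
    using rho_pos[of k] by (intro capacity_compact_cball_ge p q) simp
  also have "\<dots> \<le> capacity_open q (annulus (N k) 0 - X)"
    unfolding capacity_open_def using sub by (intro SUP_upper) auto
  finally have cap: "ennreal (pi * (1 - 2 / p) powr q * (\<rho> k / 2) powr (2 - q)) \<le> capacity_open q (annulus (N k) 0 - X)" .
  have pos: "0 < \<phi> (d k)" "0 < d k" "0 < \<beta> k" "0 < \<rho> k"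
    using phi_pos d_pos beta rho_pos by auto
  have "\<rho> k powr (2 - q) = (\<rho> k powr (1 - 2 / p)) powr q"
    by (simp only: powr_powr pq(4)[symmetric] mult.commute)
  also have "\<dots> = (\<beta> k)\<^sup>2 powr q * \<phi> (d k) powr q * d k powr q"
    unfolding rho_powr using pos by (simp add: powr_mult)
  also have "(\<beta> k)\<^sup>2 powr q = (\<beta> k powr 2) powr q" using pos by simp
  also have "\<dots> = real (Suc k) powr (- 1 / (2 * q) * 2 * q)"
    by (simp only: \<beta>_def weight_def powr_powr)
  also have "- 1 / (2 * q) * 2 * q = - 1" using pq by simp
  also have "real (Suc k) powr - 1 = 1 / real (Suc k)" by (simp add: powr_minus_divide)
  finally have \<rho>: "\<rho> k powr (2 - q) = 1 / real (Suc k) * \<phi> (d k) powr q * d k powr q" .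
  have "2 powr (real (N k) * q) = d k powr - q" by (simp add: d_def powr_powr)
  then have "\<phi> (d k) powr - q * 2 powr (real (N k) * q) * (pi * (1 - 2 / p) powr q * (\<rho> k / 2) powr (2 - q))
      = C * (1 / real (Suc k)) * (\<phi> (d k) powr - q * \<phi> (d k) powr q) * (d k powr - q * d k powr q)"
    using pos by (simp add: \<rho> C_def powr_divide mult_ac)
  also have "\<phi> (d k) powr - q * \<phi> (d k) powr q = 1" using pos by (simp flip: powr_add)
  also have "d k powr - q * d k powr q = 1" using pos by (simp flip: powr_add)
  finally have eq: "C * (1 / real (Suc k))
      = \<phi> (d k) powr - q * 2 powr (real (N k) * q) * (pi * (1 - 2 / p) powr q * (\<rho> k / 2) powr (2 - q))" by simp
  have "ennreal (C * (1 / real (Suc k))) = ennreal (\<phi> (d k) powr - q * 2 powr (real (N k) * q))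
      * ennreal (pi * (1 - 2 / p) powr q * (\<rho> k / 2) powr (2 - q))"
    unfolding eq by (rule ennreal_mult) auto
  also have "\<dots> \<le> ennreal (\<phi> (d k) powr - q * 2 powr (real (N k) * q)) * capacity_open q (annulus (N k) 0 - X)"
    by (intro mult_left_mono cap) auto
  finally show ?thesis by (simp add: C_def d_def)
qed

text \<open>The annuli with holes alone contribute a multiple of the harmonic series; a finite sum
  would bound its partial sums.\<close>

lemma capacity_series_diverges:
  "(\<Sum>n. ennreal (\<phi> (2 powr (- real (Suc n))) powr (- q) * 2 powr (real (Suc n) * q))
     * capacity_open q (annulus (Suc n) 0 - X)) = \<infinity>" (is "suminf ?a = _")
proof (rule ccontr)
  assume "suminf ?a \<noteq> \<infinity>"
  then obtain s where s: "suminf ?a = ennreal s" "0 \<le> s" by (cases "suminf ?a" rule: ennreal_cases) auto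
  define C where "C = pi * (1 - 2 / p) powr q * (1 / 2) powr (2 - q)"
  have C: "0 < C" using p by (simp add: C_def)
  \<comment> \<open>The series is indexed by \<open>Suc n\<close>, so the \<open>k\<close>-th hole
    belongs to the term \<open>N k - 1\<close>; natural subtraction is exact as
    \<open>1 \<le> N k\<close>.\<close>
  have Suc_N: "Suc (N k - 1) = N k" for k
    using N strict_mono_less_eq[OF N(1), of 0 k] by simp
  have "inj N" using N(1) by (rule strict_mono_imp_inj_on)
  then have inj: "inj (\<lambda>k. N k - 1)" by (metis (no_types, lifting) Suc_N injD injI)
  have "(\<Sum>k<n. C * (1 / real (Suc k))) \<le> s" for n
  proof -
    have "ennreal (\<Sum>k<n. C * (1 / real (Suc k))) = (\<Sum>k<n. ennreal (C * (1 / real (Suc k))))"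
      using C by (intro sum_ennreal[symmetric]) simp
    also have "\<dots> \<le> (\<Sum>k<n. ?a (N k - 1))"
      by (intro sum_mono) (simp only: Suc_N C_def capacity_term_ge)
    also have "\<dots> = sum ?a ((\<lambda>k. N k - 1) ` {..<n})"
      using inj_on_subset[OF inj, of "{..<n}"] by (simp add: sum.reindex)
    also have "\<dots> \<le> suminf ?a" by (intro sum_le_suminf summableI) auto
    finally show ?thesis using s by simp
  qed
  then have "summable (\<lambda>k. C * (1 / real (Suc k)))"
    using C by (intro summableI_nonneg_bounded[where x = s]) auto
  then have "summable (\<lambda>k. 1 / real (Suc k))" using C by (subst (asm) summable_cmult_iff) auto
  then have "summable (\<lambda>k. inverse (real k))"
    by (subst summable_Suc_iff[symmetric]) (simp add: inverse_eq_divide)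
  then show False using not_summable_harmonic[where 'a = real] by simp
qed

end

section \<open>Choice of the sparse annuli\<close>

lemma dyadic_tendsto: "filterlim (\<lambda>n. 2 powr - real n) (at_right (0 :: real)) sequentially"
proof -
  have "(\<lambda>n. 2 powr - real n) \<longlonglongrightarrow> (0 :: real)"
  proof -
    have "(\<lambda>n. (1 / 2 :: real) ^ n) \<longlonglongrightarrow> 0" by (intro LIMSEQ_power_zero) auto
    then show ?thesis by (simp add: powr_minus powr_realpow power_one_over inverse_eq_divide)
  qed
  then show ?thesis by (auto simp: filterlim_at)
qed

text \<open>On \<open>(0, 1)\<close>, \<open>\<phi>\<close> is at most \<open>\<phi> 1\<close>, so
  the radius is at most a constant times \<open>t powr e\<close> with \<open>e > 1\<close>, which is
  \<open>o(t)\<close>.\<close>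

lemma hole_radius_eventually_small:
  assumes adm: "admissible \<phi>" and q: "1 < q" "q < 2"
  shows "\<forall>\<^sub>F t in at_right 0. 64 * hole_radius \<phi> q k t \<le> weight q k * t"
proof -
  define e where "e = q / (2 - q)"
  have e: "1 < e" using q by (simp add: e_def field_simps)
  have w: "0 < weight q k" by (simp add: weight_def)
  define C where "C = 64 * ((weight q k)\<^sup>2 * \<phi> 1) powr e"
  have "\<forall>\<^sub>F t :: real in at_right 0. 0 \<le> t"
    by (rule eventually_mono[OF eventually_at_right_less]) simp
  then have "((\<lambda>t. C * t powr (e - 1)) \<longlongrightarrow> C * 0 powr (e - 1)) (at_right 0)"
    using e by (intro tendsto_intros tendsto_powr' tendsto_ident_at) auto
  then have "\<forall>\<^sub>F t in at_right 0. C * t powr (e - 1) < weight q k"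
    using w by (intro order_tendstoD) auto
  moreover have "\<forall>\<^sub>F t::real in at_right 0. 0 < t \<and> t < 1"
    unfolding eventually_at_right[OF zero_less_one] by (intro exI[of _ 1]) auto
  ultimately show ?thesis
  proof eventually_elim
    case (elim t)
    have "0 < \<phi> t" "\<phi> t \<le> \<phi> 1"
      using adm elim by (auto simp: admissible_def mono_on_def)
    then have "64 * hole_radius \<phi> q k t \<le> 64 * ((weight q k)\<^sup>2 * \<phi> 1 * t) powr e"
      unfolding hole_radius_def e_def[symmetric] using elim e w
      by (intro mult_left_mono powr_mono2 mult_right_mono) auto
    also have "\<dots> = C * t powr (e - 1) * t"
      using elim \<open>0 < \<phi> t\<close> \<open>\<phi> t \<le> \<phi> 1\<close> by (simp add: C_def powr_mult powr_diff)
    also have "\<dots> \<le> weight q k * t" using elim by (intro mult_right_mono) auto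
    finally show ?case .
  qed
qed

text \<open>Each requirement on the next index holds for all large indices, the halvings because
  \<open>\<phi>\<close> and \<open>\<psi>\<close> both tend to 0; dependent choice then builds
  \<open>N\<close>.\<close>

lemma sparse_holes_exists:
  assumes adm: "admissible \<phi>" and \<phi>0: "(\<phi> \<longlongrightarrow> 0) (at_right 0)"
    and p: "2 < p" and q: "q = p / (p - 1)"
  shows "\<exists>N. sparse_holes \<phi> p q N"
proof -
  have q12: "1 < q" "q < 2" using p by (auto simp: q field_simps)
  let ?P = "\<lambda>k n. 1 \<le> n \<and> 64 * hole_radius \<phi> q k (2 powr - real n) \<le> weight q k * 2 powr - real n"
  let ?Q = "\<lambda>n m. n < m \<and> \<phi> (2 powr - real m) \<le> \<phi> (2 powr - real n) / 2 \<and>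
      assoc_fun \<phi> (2 powr - real m) \<le> assoc_fun \<phi> (2 powr - real n) / 2"
  have P: "\<forall>\<^sub>F n in sequentially. ?P k n" for k
    using eventually_ge_at_top[of 1]
      eventually_compose_filterlim[OF hole_radius_eventually_small[OF adm q12] dyadic_tendsto]
    by eventually_elim simp
  have half: "\<forall>\<^sub>F m in sequentially. g (2 powr - real m) \<le> g (2 powr - real n) / 2"
    if "(g \<longlongrightarrow> 0) (at_right 0)" "\<forall>r>0. 0 < g r" for g :: "real \<Rightarrow> real" and n
  proof -
    have "(\<lambda>m. g (2 powr - real m)) \<longlonglongrightarrow> 0"
      using filterlim_compose[OF that(1) dyadic_tendsto] .
    then have "\<forall>\<^sub>F m in sequentially. g (2 powr - real m) < g (2 powr - real n) / 2"
      using that(2) by (intro order_tendstoD) auto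
    then show ?thesis by eventually_elim simp
  qed
  have Q: "\<forall>\<^sub>F m in sequentially. ?Q n m" for n
    using eventually_gt_at_top[of n] half[of \<phi> n] half[of "assoc_fun \<phi>" n] adm \<phi>0
    by (auto simp: admissible_def eventually_conj_iff)
  have "\<exists>N. \<forall>k. ?P k (N k) \<and> ?Q (N k) (N (Suc k))"
  proof (rule dependent_nat_choice[where P = ?P and Q = "\<lambda>k. ?Q"])
    show "\<exists>n. ?P 0 n"
      using P[of 0] eventually_happens[OF P[of 0]] by auto
    show "\<exists>m. ?P (Suc k) m \<and> ?Q n m" for n k
      using eventually_happens[OF eventually_conj[OF P[of "Suc k"] Q[of n]]] by auto
  qed
  then obtain N where "\<And>k. ?P k (N k)" "\<And>k. ?Q (N k) (N (Suc k))" by blast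
  then have "sparse_holes \<phi> p q N"
    using adm p q by (intro sparse_holes.intro) (auto simp: strict_mono_Suc_iff)
  then show ?thesis by blast
qed

theorem theorem2:
  fixes \<phi> :: "real \<Rightarrow> real" and p q :: real
  assumes "admissible \<phi>"
    and "(\<phi> \<longlongrightarrow> 0) (at_right 0)"
    and "2 < p"
    and "q = p / (p - 1)"
  shows "\<exists>X :: complex set. compact X \<and> 0 \<in> X \<and>
    (\<forall>\<epsilon>>0. full_area_density
       {y \<in> X. \<forall>f \<in> R0 X. cmod (f y - f 0) \<le> \<epsilon> * ext0 \<phi> (cmod y) * Lp_norm p X f} 0) \<and>
    (\<Sum>n. ennreal (\<phi> (2 powr (- real (Suc n))) powr (- q) * 2 powr (real (Suc n) * q))
         * capacity_open q (annulus (Suc n) 0 - X)) = \<infinity>"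
proof -
  obtain N where "sparse_holes \<phi> p q N" using sparse_holes_exists[OF assms] by blast
  then interpret sparse_holes \<phi> p q N .
  show ?thesis
    using compact_X zero_in_X estimate_set_density[unfolded estimate_set_def] capacity_series_diverges
    by blast
qed

end
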